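(* Let $\delta\geq 3$ be an integer such that $\delta+1$ is a prime power. Let $\Delta$ be an integer such that $\Delta-1$ is a positive multiple of $\delta+2$, and let $n$ be an integer such that $n-(\Delta-1)(\delta+1)-1$ is a positive multiple of $(\delta+1)(\delta+2)$. Then there exists a connected graph $G$ of order $n$, maximum degree $\Delta$ and minimum degree at least $\delta$, not containing $C_4$ as a subgraph, such that \[ \mu(G) > \frac{5}{3}\cdot\frac{M(M-1)}{n(n-1)}\cdot\frac{n+2\theta_\Delta}{\theta_\delta} - 13, \] where $\theta_\Delta=(\Delta-1)(\delta+1)+1$, $\theta_\delta=(\delta+2)(\delta+1)$, and $M=n-\theta_\Delta+\theta_\delta$.
   Context: For a connected graph $G$ of order $n\ge2$, $W(G)=\sum_{\{u,v\}\subseteq V(G)} d_G(u,v)$ is the Wiener index and $\mu(G)=\binom{n}{2}^{-1}W(G)$ is the average distance. $C_4$ is the cycle on four vertices; "not containing $C_4$ as a subgraph" refers to any (not necessarily induced) subgraph. *)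

theory Defs
  imports Complex_Main "HOL-Computational_Algebra.Primes"
begin

definition sgraph :: "'a set \<Rightarrow> ('a \<Rightarrow> 'a \<Rightarrow> bool) \<Rightarrow> bool" where
  "sgraph V E \<longleftrightarrow> finite V \<and> (\<forall>u v. E u v \<longrightarrow> u \<in> V \<and> v \<in> V)
     \<and> (\<forall>u v. E u v \<longrightarrow> E v u) \<and> (\<forall>u. \<not> E u u)"

fun walk_len :: "('a \<Rightarrow> 'a \<Rightarrow> bool) \<Rightarrow> nat \<Rightarrow> 'a \<Rightarrow> 'a \<Rightarrow> bool" where
  "walk_len E 0 u v = (u = v)"
| "walk_len E (Suc k) u v = (\<exists>w. E u w \<and> walk_len E k w v)"

definition connected_graph :: "'a set \<Rightarrow> ('a \<Rightarrow> 'a \<Rightarrow> bool) \<Rightarrow> bool" where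
  "connected_graph V E \<longleftrightarrow> (\<forall>u\<in>V. \<forall>v\<in>V. \<exists>k. walk_len E k u v)"

definition gdist :: "('a \<Rightarrow> 'a \<Rightarrow> bool) \<Rightarrow> 'a \<Rightarrow> 'a \<Rightarrow> nat" where
  "gdist E u v = (LEAST k. walk_len E k u v)"

definition degree :: "'a set \<Rightarrow> ('a \<Rightarrow> 'a \<Rightarrow> bool) \<Rightarrow> 'a \<Rightarrow> nat" where
  "degree V E v = card {w \<in> V. E v w}"

definition max_degree :: "'a set \<Rightarrow> ('a \<Rightarrow> 'a \<Rightarrow> bool) \<Rightarrow> nat" where
  "max_degree V E = Max (degree V E ` V)"

definition min_degree :: "'a set \<Rightarrow> ('a \<Rightarrow> 'a \<Rightarrow> bool) \<Rightarrow> nat" where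
  "min_degree V E = Min (degree V E ` V)"

definition has_C4 :: "'a set \<Rightarrow> ('a \<Rightarrow> 'a \<Rightarrow> bool) \<Rightarrow> bool" where
  "has_C4 V E \<longleftrightarrow> (\<exists>a\<in>V. \<exists>b\<in>V. \<exists>c\<in>V. \<exists>d\<in>V. distinct [a, b, c, d]
      \<and> E a b \<and> E b c \<and> E c d \<and> E d a)"

definition wiener :: "'a::linorder set \<Rightarrow> ('a \<Rightarrow> 'a \<Rightarrow> bool) \<Rightarrow> real" where
  "wiener V E = (\<Sum>(u, v)\<in>{(u, v). u \<in> V \<and> v \<in> V \<and> u < v}. real (gdist E u v))"

definition avg_dist :: "'a::linorder set \<Rightarrow> ('a \<Rightarrow> 'a \<Rightarrow> bool) \<Rightarrow> real" where
  "avg_dist V E = wiener V E / real (card V choose 2)"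

definition prime_power :: "nat \<Rightarrow> bool" where
  "prime_power q \<longleftrightarrow> (\<exists>p k. prime p \<and> k \<ge> 1 \<and> q = p ^ k)"

end

theory Submission
  imports "HOL-Algebra.Algebraic_Closure" "HOL-Number_Theory.Residues" Defs
begin

text \<open>
  Let \<open>q = \<delta> + 1\<close> and take a polarity of the projective plane of order \<open>q\<close>. Its polarity graph
  has \<open>q\<^sup>2 + q + 1\<close> vertices of degree at least \<open>q\<close>, and it is \<open>C\<^sub>4\<close>-free because two points have
  exactly one common polar point. Fix a point \<open>z\<close> that is not absolute, and two non-adjacent
  neighbours \<open>u\<close>, \<open>v\<close> of \<open>z\<close>. Deleting \<open>z\<close> and all edges between the neighbourhoods of \<open>u\<close> and of
  \<open>v\<close> costs every vertex at most one neighbour, and it leaves a connected block of \<open>q(q + 1)\<close>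
  vertices in which \<open>u\<close> and \<open>v\<close> have distance at least 4. The vertex of degree \<open>\<Delta>\<close> is the common
  point \<open>z\<close> of \<open>m\<close> polarity graphs glued together at \<open>z\<close>; a path of \<open>k\<close> blocks is attached to it by
  bridges, each of which leads to the vertex \<open>u\<close> of a block and leaves the previous block at \<open>v\<close>.
  Two vertices whose blocks have positions \<open>i\<close> and \<open>j\<close> then have distance at least
  \<open>5\<bar>i - j\<bar> - 4\<close>, and summing over all pairs gives the bound.
\<close>

section \<open>Finite domains of prime power order\<close>

text \<open>Induction on \<open>n\<close> with Pascal's rule. Multiplying the term
  \<open>t c i j\<close> by \<open>x\<close> or \<open>y\<close> raises one exponent and leaves the
  coefficient alone.\<close>

lemma (in cring) binomial_expansion:
  assumes x: "x \<in> carrier R" and y: "y \<in> carrier R"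
  shows "(x \<oplus> y) [^] n = (\<Oplus>i\<in>{..n}. [(n choose i)] \<cdot> (x [^] i \<otimes> y [^] (n - i)))"
proof (induction n)
  case 0
  show ?case using x y by simp
next
  case (Suc n)
  define t where "t c i j = [c] \<cdot> (x [^] i \<otimes> y [^] j)" for c i j :: nat
  have t: "t c i j \<in> carrier R" for c i j
    using x y by (simp add: t_def)
  have tx: "t c i j \<otimes> x = t c (Suc i) j" for c i j
    using x y by (simp add: t_def add_pow_ldistr add_pow_rdistr m_ac)
  have ty: "t c i j \<otimes> y = t c i (Suc j)" for c i j
    using x y by (simp add: t_def add_pow_ldistr add_pow_rdistr m_ac)
  have tadd: "t (c + d) i j = t c i j \<oplus> t d i j" for c d i j
    using x y by (simp add: t_def add.nat_pow_mult)
  have t0: "t 0 i j = \<zero>" for i j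
    by (simp add: t_def)
  let ?A = "\<Oplus>i\<in>{..n}. t (n choose i) (Suc i) (n - i)"
  have "(\<Oplus>i\<in>{..n}. t (n choose i) i (n - i)) \<otimes> y = (\<Oplus>i\<in>{..n}. t (n choose i) i (Suc (n - i)))"
    using y t by (simp add: finsum_ldistr ty)
  also have "\<dots> = (\<Oplus>i\<in>{..n}. t (n choose i) i (Suc n - i))"
    by (intro finsum_cong') (auto simp: t Suc_diff_le)
  \<comment> \<open>The added term has the coefficient \<open>n choose Suc n\<close>, which is 0. It
    allows the term \<open>i = 0\<close> to be split off, so that the rest lines up with the
    \<open>x\<close> part.\<close>
  also have "\<dots> = (\<Oplus>i\<in>{..Suc n}. t (n choose i) i (Suc n - i))"
    using t by (simp add: t0 Pi_def binomial_eq_0)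
  also have "\<dots> = (\<Oplus>i\<in>{..n}. t (n choose Suc i) (Suc i) (n - i)) \<oplus> t 1 0 (Suc n)"
    using t by (subst finsum_Suc2) auto
  finally have y_part: "(\<Oplus>i\<in>{..n}. t (n choose i) i (n - i)) \<otimes> y = \<dots>" .
  have "(x \<oplus> y) [^] Suc n = (\<Oplus>i\<in>{..n}. t (n choose i) i (n - i)) \<otimes> (x \<oplus> y)"
    using Suc.IH by (simp add: t_def)
  also have "\<dots> = ?A \<oplus> ((\<Oplus>i\<in>{..n}. t (n choose Suc i) (Suc i) (n - i)) \<oplus> t 1 0 (Suc n))"
    using x y t by (simp add: r_distr y_part finsum_ldistr tx)
  also have "\<dots> = (\<Oplus>i\<in>{..n}. t (Suc n choose Suc i) (Suc i) (n - i)) \<oplus> t 1 0 (Suc n)"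
    using t by (simp add: tadd finsum_addf a_assoc)
  also have "\<dots> = (\<Oplus>i\<in>{..Suc n}. t (Suc n choose i) i (Suc n - i))"
    using t by (subst finsum_Suc2) auto
  finally show ?case by (simp only: t_def)
qed

text \<open>All inner binomial coefficients \<open>p choose i\<close> are multiples of
  \<open>p\<close>, and multiples of \<open>p\<close> annihilate the ring by \<open>kill\<close>;
  only the two outer terms survive.\<close>

lemma (in cring) frobenius_add:
  assumes p: "Factorial_Ring.prime (p::nat)" and char: "[p] \<cdot> \<one> = \<zero>"
    and x: "x \<in> carrier R" and y: "y \<in> carrier R"
  shows "(x \<oplus> y) [^] p = x [^] p \<oplus> y [^] p"
proof -
  have kill: "[c] \<cdot> a = \<zero>" if "p dvd c" "a \<in> carrier R" for a and c :: nat
  proof -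
    from \<open>p dvd c\<close> obtain d where "c = p * d" ..
    then have "[c] \<cdot> a = [d] \<cdot> (([p] \<cdot> \<one>) \<otimes> a)"
      using that by (simp add: add_pow_ldistr add.nat_pow_pow)
    then show ?thesis using char that by simp
  qed
  obtain k where k: "p = Suc k" using prime_gt_0_nat[OF p] gr0_conv_Suc by blast
  let ?f = "\<lambda>i. [(p choose i)] \<cdot> (x [^] i \<otimes> y [^] (p - i))"
  have f: "?f i \<in> carrier R" for i using x y by simp
  have "(x \<oplus> y) [^] p = (\<Oplus>i\<in>{..Suc k}. ?f i)"
    using binomial_expansion[OF x y, of p] k by simp
  also have "\<dots> = ?f p \<oplus> (\<Oplus>i\<in>{..k}. ?f i)"
    using f k by (subst finsum_Suc) auto
  also have "(\<Oplus>i\<in>{..k}. ?f i) = (\<Oplus>i\<in>{..k}. if i = 0 then y [^] p else \<zero>)"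
  proof (intro finsum_cong')
    fix i assume "i \<in> {..k}"
    show "?f i = (if i = 0 then y [^] p else \<zero>)"
    proof (cases "i = 0")
      case False
      have "p dvd (p choose i)"
        using \<open>i \<in> {..k}\<close> False k p by (intro dvd_choose_prime) auto
      then show ?thesis using kill x y False by simp
    qed (use x y in simp)
  qed (use y in auto)
  also have "\<dots> = y [^] p"
    using y add.finprod_singleton_swap[of 0 "{..k}" "\<lambda>_. y [^] p"] by (simp add: eq_commute)
  finally show ?thesis using x y by simp
qed

lemma (in cring) frobenius_pow_add:
  assumes p: "Factorial_Ring.prime (p::nat)" and char: "[p] \<cdot> \<one> = \<zero>"
    and x: "x \<in> carrier R" and y: "y \<in> carrier R"
  shows "(x \<oplus> y) [^] (p ^ k) = x [^] (p ^ k) \<oplus> y [^] (p ^ k)"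
proof (induction k)
  case 0
  show ?case using x y by simp
next
  case (Suc k)
  have pow: "z [^] (p ^ Suc k) = (z [^] (p ^ k)) [^] p" if "z \<in> carrier R" for z
    using that by (simp add: nat_pow_pow mult.commute)
  show ?case
    using Suc x y by (simp only: pow a_closed) (simp add: frobenius_add[OF p char])
qed

text \<open>Additivity is applied to \<open>(x - y) + y\<close>, so the sign of a power of -1 never
  has to be determined.\<close>

lemma (in cring) frobenius_pow_minus:
  assumes p: "Factorial_Ring.prime (p::nat)" and char: "[p] \<cdot> \<one> = \<zero>"
    and x: "x \<in> carrier R" and y: "y \<in> carrier R"
  shows "(x \<ominus> y) [^] (p ^ k) = x [^] (p ^ k) \<ominus> y [^] (p ^ k)"
proof -
  have "(x \<ominus> y) [^] (p ^ k) \<oplus> y [^] (p ^ k) = ((x \<ominus> y) \<oplus> y) [^] (p ^ k)"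
    using x y by (simp add: frobenius_pow_add[OF p char])
  also have "(x \<ominus> y) \<oplus> y = x"
    using x y by algebra
  finally show ?thesis
    using x y by (metis add.inv_solve_right minus_eq minus_closed nat_pow_closed)
qed

lemma ring_hom_add_pow:
  assumes "h \<in> ring_hom R S" "ring R" "ring S" "x \<in> carrier R"
  shows "h ([n] \<cdot>\<^bsub>R\<^esub> x) = [(n::nat)] \<cdot>\<^bsub>S\<^esub> h x"
proof -
  interpret R: ring R by fact
  interpret S: ring S by fact
  interpret h: ring_hom_ring R S h
    using assms by (simp add: ring_hom_ringI2)
  show ?thesis using assms(4) by (induction n) auto
qed

context field
begin

text \<open>The fixed points are the roots of \<open>X^q - X\<close>, which splits over an
  algebraically closed field and so has \<open>q\<close> roots counted with multiplicity. The work
  lies in showing that each root is simple.\<close>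

lemma card_frobenius_fixed:
  assumes closed: "algebraically_closed R"
    and p: "Factorial_Ring.prime (p::nat)" and char: "[p] \<cdot> \<one> = \<zero>" and k: "k \<ge> 1"
  shows "card {x \<in> carrier R. x [^] (p ^ k) = x} = p ^ k" (is "card ?S = _")
    and "finite {x \<in> carrier R. x [^] (p ^ k) = x}"
proof -
  interpret closed: algebraically_closed R by fact
  interpret UP: domain "poly_ring R"
    using univ_poly_is_domain[OF carrier_is_subring] .
  define q where "q = p ^ k"
  have q: "q \<ge> 2"
    using prime_ge_2_nat[OF p] k unfolding q_def
    by (metis le_trans self_le_power one_le_numeral order_trans zero_less_one less_le_trans)
  let ?P = "X [^]\<^bsub>poly_ring R\<^esub> q \<ominus>\<^bsub>poly_ring R\<^esub> X"
  have X: "X \<in> carrier (poly_ring R)"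
    using var_closed(1)[OF carrier_is_subring] .
  have Xq: "X [^]\<^bsub>poly_ring R\<^esub> q \<in> carrier (poly_ring R)"
    using X by simp
  have P: "?P \<in> carrier (poly_ring R)"
    using X by simp
  have "Polynomials.degree (X [^]\<^bsub>poly_ring R\<^esub> q) = q"
    using polynomial_pow_degree[OF X, of q] by (simp add: var_def)
  moreover have "Polynomials.degree (\<ominus>\<^bsub>poly_ring R\<^esub> X) = 1"
    using univ_poly_a_inv_degree[OF carrier_is_subring X] by (simp add: var_def)
  ultimately have deg: "Polynomials.degree ?P = q"
    using poly_add_degree_eq[OF carrier_is_subring, of "X [^]\<^bsub>poly_ring R\<^esub> q" "\<ominus>\<^bsub>poly_ring R\<^esub> X"]
      q X Xq UP.a_inv_closed[OF X]
    by (simp add: a_minus_def univ_poly_carrier univ_poly_add)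
  then have "?P \<noteq> []"
    using q by auto
  have ev: "eval ?P a = a [^] q \<ominus> a" if a: "a \<in> carrier R" for a
  proof -
    interpret ev: ring_hom_ring "poly_ring R" R "\<lambda>p. eval p a"
      by (rule eval_ring_hom[OF carrier_is_subring a])
    interpret ev: ring_hom_cring "poly_ring R" R "\<lambda>p. eval p a"
      by (rule eval_cring_hom[OF carrier_is_subring a])
    show ?thesis
      using X a by (simp add: a_minus_def eval_var)
  qed
  have root: "is_root ?P a \<longleftrightarrow> a \<in> ?S" for a
    using \<open>?P \<noteq> []\<close> by (auto simp: is_root_def ev q_def[symmetric])
  have simple: "count (roots ?P) a = 1" if "a \<in># roots ?P" for a
  proof (rule ccontr)
    assume "count (roots ?P) a \<noteq> 1"
    moreover have "count (roots ?P) a > 0"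
      using that by simp
    ultimately have mult: "2 \<le> alg_mult ?P a"
      unfolding alg_mult_eq_count_roots[OF P] by linarith
    have a: "a \<in> carrier R" and aq: "a [^] q = a"
      using that roots_mem_iff_is_root[OF P] root by (auto simp: q_def)
    let ?D = "[\<one>, \<ominus> a]"
    have D: "?D \<in> carrier (poly_ring R)"
      using a unfolding sym[OF univ_poly_carrier] polynomial_def by auto
    obtain g where g: "g \<in> carrier (poly_ring R)"
      and Pg: "?P = ?D [^]\<^bsub>poly_ring R\<^esub> (2::nat) \<otimes>\<^bsub>poly_ring R\<^esub> g"
      using le_alg_mult_imp_pdivides[OF a P mult] unfolding pdivides_def by blast
    interpret c: ring_hom_ring R "poly_ring R" poly_of_const
      using canonical_embedding_ring_hom[OF carrier_is_subring] by simp
    let ?c = "poly_of_const a"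
    have c: "?c \<in> carrier (poly_ring R)"
      using a by simp
    have Dc: "?D = X \<ominus>\<^bsub>poly_ring R\<^esub> ?c"
    proof -
      have "X \<ominus>\<^bsub>poly_ring R\<^esub> ?c = X \<oplus>\<^bsub>poly_ring R\<^esub> poly_of_const (\<ominus> a)"
        using a by (simp add: a_minus_def)
      also have "\<dots> = ?D"
        using a by (simp add: univ_poly_add var_def poly_of_const_def)
      finally show ?thesis ..
    qed
    have "[p] \<cdot>\<^bsub>poly_ring R\<^esub> \<one>\<^bsub>poly_ring R\<^esub> = poly_of_const ([p] \<cdot> \<one>)"
      using ring_hom_add_pow[OF c.homh ring_axioms UP.ring_axioms one_closed] by simp
    then have charP: "[p] \<cdot>\<^bsub>poly_ring R\<^esub> \<one>\<^bsub>poly_ring R\<^esub> = \<zero>\<^bsub>poly_ring R\<^esub>"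
      using char by simp
    \<comment> \<open>As \<open>a\<close> is a fixed point of the Frobenius map, \<open>X\<^sup>q - X = (X - a)\<^sup>q - (X - a)\<close>, which \<open>(X - a)\<^sup>2\<close> does not divide.\<close>
    have "?D [^]\<^bsub>poly_ring R\<^esub> q \<ominus>\<^bsub>poly_ring R\<^esub> ?D
        = (X [^]\<^bsub>poly_ring R\<^esub> q \<ominus>\<^bsub>poly_ring R\<^esub> ?c [^]\<^bsub>poly_ring R\<^esub> q)
          \<ominus>\<^bsub>poly_ring R\<^esub> (X \<ominus>\<^bsub>poly_ring R\<^esub> ?c)"
      unfolding Dc q_def by (simp only: UP.frobenius_pow_minus[OF p charP X c])
    also have "?c [^]\<^bsub>poly_ring R\<^esub> q = ?c"
      using aq a by (metis c.hom_nat_pow)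
    also have "(X [^]\<^bsub>poly_ring R\<^esub> q \<ominus>\<^bsub>poly_ring R\<^esub> ?c) \<ominus>\<^bsub>poly_ring R\<^esub> (X \<ominus>\<^bsub>poly_ring R\<^esub> ?c) = ?P"
      using X c Xq by algebra
    finally have PD: "?P = ?D [^]\<^bsub>poly_ring R\<^esub> q \<ominus>\<^bsub>poly_ring R\<^esub> ?D" ..
    \<comment> \<open>Both forms of \<open>?P\<close> give \<open>?D^2 g = ?D^q - ?D\<close>.
      Cancelling one factor \<open>?D\<close> leaves \<open>?D h = 1\<close>, and evaluation at the
      root \<open>a\<close> of \<open>?D\<close> turns this into \<open>0 = 1\<close>.\<close>
    define h where "h = ?D [^]\<^bsub>poly_ring R\<^esub> (q - 2) \<ominus>\<^bsub>poly_ring R\<^esub> g"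
    have h: "h \<in> carrier (poly_ring R)"
      using D g by (simp add: h_def)
    let ?E = "?D [^]\<^bsub>poly_ring R\<^esub> (q - 2)"
    have E: "?E \<in> carrier (poly_ring R)"
      using D by simp
    have "?D [^]\<^bsub>poly_ring R\<^esub> q = ?D \<otimes>\<^bsub>poly_ring R\<^esub> (?D \<otimes>\<^bsub>poly_ring R\<^esub> ?E)"
    proof -
      have "q = 1 + (1 + (q - 2))" using q by simp
      then show ?thesis
        using UP.nat_pow_mult[OF D] D by (metis UP.nat_pow_eone)
    qed
    moreover have "?P = ?D \<otimes>\<^bsub>poly_ring R\<^esub> (?D \<otimes>\<^bsub>poly_ring R\<^esub> g)"
      using Pg D g by (simp add: numeral_2_eq_2 UP.m_assoc)
    ultimately have "?D \<otimes>\<^bsub>poly_ring R\<^esub> (?D \<otimes>\<^bsub>poly_ring R\<^esub> g)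
        = ?D \<otimes>\<^bsub>poly_ring R\<^esub> (?D \<otimes>\<^bsub>poly_ring R\<^esub> ?E) \<ominus>\<^bsub>poly_ring R\<^esub> ?D"
      using PD by simp
    then have "?D \<otimes>\<^bsub>poly_ring R\<^esub> (?D \<otimes>\<^bsub>poly_ring R\<^esub> h) = ?D \<otimes>\<^bsub>poly_ring R\<^esub> \<one>\<^bsub>poly_ring R\<^esub>"
      unfolding h_def using D g E by algebra
    moreover have "?D \<noteq> \<zero>\<^bsub>poly_ring R\<^esub>"
      by (simp add: univ_poly_zero)
    ultimately have Dh: "?D \<otimes>\<^bsub>poly_ring R\<^esub> h = \<one>\<^bsub>poly_ring R\<^esub>"
      using D h UP.m_lcancel[of ?D "?D \<otimes>\<^bsub>poly_ring R\<^esub> h" "\<one>\<^bsub>poly_ring R\<^esub>"] by simp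
    interpret ev: ring_hom_ring "poly_ring R" R "\<lambda>p. eval p a"
      by (rule eval_ring_hom[OF carrier_is_subring a])
    have "eval ?D a = \<zero>"
      using a by (simp add: r_neg)
    then have "eval (?D \<otimes>\<^bsub>poly_ring R\<^esub> h) a = \<zero>"
      using D h by (simp only: ev.hom_mult ev.hom_closed l_null)
    then show False
      unfolding Dh by simp
  qed
  have S: "?S = set_mset (roots ?P)"
    using roots_mem_iff_is_root[OF P] root by blast
  then show "finite ?S"
    by simp
  have "card ?S = size (roots ?P)"
    unfolding S size_multiset_overloaded_eq using simple by simp
  also have "\<dots> = q"
    using closed.roots_over_carrier[OF P] deg by (simp add: splitted_def)
  finally show "card ?S = p ^ k"
    by (simp add: q_def)
qed

end


text \<open>Inside an algebraic closure of the integers mod \<open>p\<close>, the fixed points of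
  the map raising to the power \<open>p^k\<close> form a subring with exactly \<open>q\<close>
  elements. The element type is the one produced by the construction of the closure.\<close>

lemma finite_domain_exists:
  assumes "prime_power q"
  obtains R :: "((int list \<times> nat) multiset \<Rightarrow> int) ring"
    where "domain R" "finite (carrier R)" "card (carrier R) = q"
proof -
  from assms obtain p k where p: "Factorial_Ring.prime p" and k: "k \<ge> 1" and q: "q = p ^ k"
    unfolding prime_power_def by blast
  interpret K: residues_prime p "residue_ring (int p)"
    using p by unfold_locales auto
  obtain L :: "((int list \<times> nat) multiset \<Rightarrow> int) ring"
    where closure: "algebraic_closure L (ring.indexed_const (residue_ring (int p)) ` carrier (residue_ring (int p)))"
      and hom: "ring.indexed_const (residue_ring (int p)) \<in> ring_hom (residue_ring (int p)) L"
    using K.exists_closure by blast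
  interpret L: algebraic_closure L "ring.indexed_const (residue_ring (int p)) ` carrier (residue_ring (int p))"
    by fact
  have "[n] \<cdot>\<^bsub>residue_ring (int p)\<^esub> \<one>\<^bsub>residue_ring (int p)\<^esub> = int n mod int p" for n :: nat
    by (induction n) (auto simp: K.res_zero_eq K.res_one_eq K.res_add_eq mod_simps add.commute)
  then have "[p] \<cdot>\<^bsub>residue_ring (int p)\<^esub> \<one>\<^bsub>residue_ring (int p)\<^esub> = \<zero>\<^bsub>residue_ring (int p)\<^esub>"
    by (simp add: K.res_zero_eq)
  then have char: "[p] \<cdot>\<^bsub>L\<^esub> \<one>\<^bsub>L\<^esub> = \<zero>\<^bsub>L\<^esub>"
    using ring_hom_add_pow[OF hom K.ring_axioms L.ring_axioms K.one_closed, of p]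
      ring_hom_one[OF hom] ring_hom_zero[OF hom K.ring_axioms L.ring_axioms] by simp
  let ?S = "{x \<in> carrier L. x [^]\<^bsub>L\<^esub> (p ^ k) = x}"
  have zero_pow: "\<zero>\<^bsub>L\<^esub> [^]\<^bsub>L\<^esub> (p ^ k) = \<zero>\<^bsub>L\<^esub>"
    using p by (simp add: L.nat_pow_zero)
  have "subring ?S L"
  proof (rule L.subringI)
    \<comment> \<open>Closure under negation is read off from the difference
      \<open>0 - h\<close>.\<close>
    fix h assume h: "h \<in> ?S"
    have "(\<zero>\<^bsub>L\<^esub> \<ominus>\<^bsub>L\<^esub> h) [^]\<^bsub>L\<^esub> (p ^ k) = \<zero>\<^bsub>L\<^esub> \<ominus>\<^bsub>L\<^esub> h"
      using h zero_pow L.frobenius_pow_minus[OF p char, of "\<zero>\<^bsub>L\<^esub>" h k] by simp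
    then show "\<ominus>\<^bsub>L\<^esub> h \<in> ?S"
      using h by (simp add: a_minus_def)
  qed (auto simp: L.frobenius_pow_add[OF p char] L.nat_pow_distrib)
  then have "domain (L\<lparr>carrier := ?S\<rparr>)"
    by (rule L.subring_is_domain)
  moreover have "algebraically_closed L" ..
  ultimately show ?thesis
    using L.card_frobenius_fixed[OF _ p char k] q that[of "L\<lparr>carrier := ?S\<rparr>"] by simp
qed

section \<open>Polarities of projective planes\<close>

text \<open>The set \<open>{y. inc x y}\<close> is the polar line of \<open>x\<close>. Identifying
  lines with their poles turns the axioms of a plane of order \<open>q\<close> into statements about
  one symmetric relation on points; the absolute points are those with
  \<open>inc x x\<close>.\<close>

locale polarity =
  fixes P :: "'p set" and inc :: "'p \<Rightarrow> 'p \<Rightarrow> bool" and q :: nat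
  assumes finite_points: "finite P"
    and card_points: "card P = q * (q + 1) + 1"
    and inc_point: "inc x y \<Longrightarrow> x \<in> P"
    and inc_sym: "inc x y \<Longrightarrow> inc y x"
    and card_polar: "x \<in> P \<Longrightarrow> card {y. inc x y} = q + 1"
    and meet: "x \<in> P \<Longrightarrow> y \<in> P \<Longrightarrow> x \<noteq> y \<Longrightarrow> \<exists>w. inc x w \<and> inc y w"
    and meet_unique: "x \<noteq> y \<Longrightarrow> inc x w \<Longrightarrow> inc y w \<Longrightarrow> inc x w' \<Longrightarrow> inc y w' \<Longrightarrow> w = w'"

context domain
begin

text \<open>
  The point with homogeneous coordinates \<open>(1, a, b)\<close> is \<open>Inl (a, b)\<close>, the point \<open>(0, 1, a)\<close> is
  \<open>Inr (Some a)\<close>, and \<open>(0, 0, 1)\<close> is \<open>Inr None\<close>. The polarity comes from the bilinear form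
  \<open>x\<^sub>1 y\<^sub>3 + x\<^sub>3 y\<^sub>1 - x\<^sub>2 y\<^sub>2\<close>. No inverses are needed, so a finite domain suffices.
\<close>

fun polar :: "'a \<times> 'a + 'a option \<Rightarrow> 'a \<times> 'a + 'a option \<Rightarrow> bool" where
  "polar (Inl (a, b)) (Inl (c, d)) \<longleftrightarrow> b \<oplus> d = a \<otimes> c"
| "polar (Inl (a, b)) (Inr s) \<longleftrightarrow> s = Some a"
| "polar (Inr s) (Inl (a, b)) \<longleftrightarrow> s = Some a"
| "polar (Inr s) (Inr t) \<longleftrightarrow> s = None \<or> t = None"

definition points :: "('a \<times> 'a + 'a option) set" where
  "points = (carrier R \<times> carrier R) <+> insert None (Some ` carrier R)"

lemma points_cases:
  assumes "x \<in> points"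
  obtains (aff) a b where "x = Inl (a, b)" "a \<in> carrier R" "b \<in> carrier R"
  | (slope) a where "x = Inr (Some a)" "a \<in> carrier R"
  | (inf) "x = Inr None"
  using assms by (auto simp: points_def)

lemma points_simps [simp]:
  "Inl (a, b) \<in> points \<longleftrightarrow> a \<in> carrier R \<and> b \<in> carrier R"
  "Inr (Some a) \<in> points \<longleftrightarrow> a \<in> carrier R"
  "Inr None \<in> points"
  by (auto simp: points_def)

lemma polar_sym:
  assumes "x \<in> points" "y \<in> points" "polar x y"
  shows "polar y x"
  using assms(1,2)
  by (cases rule: points_cases[case_product points_cases])
    (use assms(3) in \<open>auto simp: a_comm m_comm\<close>)

text \<open>This takes the place of division: multiplication by \<open>a\<close> is injective by
  cancellation, hence surjective on a finite carrier.\<close>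

lemma finite_mult_surj:
  assumes fin: "finite (carrier R)" and a: "a \<in> carrier R" "a \<noteq> \<zero>" and b: "b \<in> carrier R"
  obtains c where "c \<in> carrier R" "a \<otimes> c = b"
proof -
  have "inj_on (\<lambda>c. a \<otimes> c) (carrier R)"
    using a by (intro inj_onI) (simp add: m_lcancel)
  then have "(\<lambda>c. a \<otimes> c) ` carrier R = carrier R"
    using fin a by (intro endo_inj_surj) auto
  then show ?thesis
    using b that by (metis imageE)
qed

lemma polarity_points:
  assumes fin: "finite (carrier R)" and card: "card (carrier R) = q"
  shows "polarity points (\<lambda>x y. x \<in> points \<and> y \<in> points \<and> polar x y) q"
proof
  show "finite points"
    using fin by (simp add: points_def)
  have "card (insert None (Some ` carrier R)) = q + 1"
    using fin card by (subst card_insert_disjoint) (auto simp: card_image)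
  then show "card points = q * (q + 1) + 1"
    using fin card by (simp add: points_def card_Plus card_cartesian_product)
next
  fix x assume x: "x \<in> points"
  then show "card {y. x \<in> points \<and> y \<in> points \<and> polar x y} = q + 1"
  proof (cases rule: points_cases)
    case (aff a b)
    \<comment> \<open>On the polar line of an affine point the first coordinate determines the
      second. This gives \<open>q\<close> affine points, and one point at infinity completes the
      line.\<close>
    have *: "b \<oplus> d = a \<otimes> c \<longleftrightarrow> d = a \<otimes> c \<ominus> b" if "c \<in> carrier R" "d \<in> carrier R" for c d
      using that aff by (metis a_comm a_minus_def add.inv_solve_right m_closed)
    have "{y. x \<in> points \<and> y \<in> points \<and> polar x y}
        = insert (Inr (Some a)) ((\<lambda>c. Inl (c, a \<otimes> c \<ominus> b)) ` carrier R)"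
      using aff * by (auto simp: image_iff elim!: points_cases)
    also have "card \<dots> = Suc (card ((\<lambda>c. Inl (c, a \<otimes> c \<ominus> b) :: _ + 'a option) ` carrier R))"
      using fin by (subst card_insert_disjoint) auto
    also have "\<dots> = q + 1"
      using card by (subst card_image) (auto simp: inj_on_def)
    finally show ?thesis .
  next
    case (slope a)
    have "{y. x \<in> points \<and> y \<in> points \<and> polar x y}
        = insert (Inr None) ((\<lambda>b. Inl (a, b)) ` carrier R)"
      using slope by (auto simp: image_iff elim!: points_cases)
    also have "card \<dots> = Suc (card ((\<lambda>b. Inl (a, b) :: _ + 'a option) ` carrier R))"
      using fin by (subst card_insert_disjoint) auto
    also have "\<dots> = q + 1"
      using card by (subst card_image) (auto simp: inj_on_def)
    finally show ?thesis .
  next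
    case inf
    have "{y. x \<in> points \<and> y \<in> points \<and> polar x y}
        = insert (Inr None) ((\<lambda>b. Inr (Some b)) ` carrier R)"
      using inf by (auto simp: image_iff elim!: points_cases)
    also have "card \<dots> = Suc (card ((\<lambda>b. Inr (Some b) :: ('a \<times> 'a) + 'a option) ` carrier R))"
      using fin by (subst card_insert_disjoint) auto
    also have "\<dots> = q + 1"
      using card by (subst card_image) (auto simp: inj_on_def)
    finally show ?thesis .
  qed
next
  fix x y assume x: "x \<in> points" and y: "y \<in> points" and "x \<noteq> y"
  have meet: "\<exists>w\<in>points. polar x w \<and> polar y w"
    using x y
  proof (cases rule: points_cases[case_product points_cases])
    case (aff_aff a b c d)
    show ?thesis
    proof (cases "a = c")
      case True
      then show ?thesis using aff_aff by (intro bexI[of _ "Inr (Some a)"]) auto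
    next
      case False
      \<comment> \<open>Equating the second coordinates \<open>a e - b\<close> and
        \<open>c e - d\<close> on the two polar lines leaves this linear equation for the first
        coordinate.\<close>
      then obtain e where e: "e \<in> carrier R" "(a \<ominus> c) \<otimes> e = b \<ominus> d"
        using aff_aff finite_mult_surj[OF fin, of "a \<ominus> c" "b \<ominus> d"] by (auto simp: r_right_minus_eq)
      have "a \<otimes> e \<ominus> b = (a \<ominus> c) \<otimes> e \<oplus> (c \<otimes> e \<ominus> b)"
        using aff_aff e(1) by algebra
      also have "\<dots> = c \<otimes> e \<ominus> d"
        unfolding e(2) using aff_aff e(1) by algebra
      finally have eq: "a \<otimes> e \<ominus> b = c \<otimes> e \<ominus> d" .
      have "b \<oplus> (a \<otimes> e \<ominus> b) = a \<otimes> e" "d \<oplus> (c \<otimes> e \<ominus> d) = c \<otimes> e"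
        using aff_aff e(1) by algebra+
      then show ?thesis
        using aff_aff e(1) eq by (intro bexI[of _ "Inl (e, a \<otimes> e \<ominus> b)"]) auto
    qed
  next
    case (aff_slope a b c)
    have "b \<oplus> (a \<otimes> c \<ominus> b) = a \<otimes> c"
      using aff_slope by algebra
    then show ?thesis
      using aff_slope by (intro bexI[of _ "Inl (c, a \<otimes> c \<ominus> b)"]) auto
  next
    case (aff_inf a b)
    then show ?thesis by (intro bexI[of _ "Inr (Some a)"]) auto
  next
    case (slope_aff c a b)
    have "b \<oplus> (a \<otimes> c \<ominus> b) = a \<otimes> c"
      using slope_aff by algebra
    then show ?thesis
      using slope_aff by (intro bexI[of _ "Inl (c, a \<otimes> c \<ominus> b)"]) auto
  next
    case (inf_aff a b)
    then show ?thesis by (intro bexI[of _ "Inr (Some a)"]) auto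
  qed (auto intro!: bexI[of _ "Inr None"])
  then show "\<exists>w. (x \<in> points \<and> w \<in> points \<and> polar x w) \<and> y \<in> points \<and> w \<in> points \<and> polar y w"
    using x y by blast
next
  fix x y w w'
  assume "x \<noteq> y"
    and 1: "x \<in> points \<and> w \<in> points \<and> polar x w" "y \<in> points \<and> w \<in> points \<and> polar y w"
      "x \<in> points \<and> w' \<in> points \<and> polar x w'" "y \<in> points \<and> w' \<in> points \<and> polar y w'"
  \<comment> \<open>Two polar lines of different slope cannot share two affine points: subtracting
    the four equations gives \<open>(a - c)(e - g) = 0\<close>.\<close>
  have key: False
    if "a \<in> carrier R" "b \<in> carrier R" "c \<in> carrier R" "d \<in> carrier R"
      "e \<in> carrier R" "f \<in> carrier R" "g \<in> carrier R" "h \<in> carrier R"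
      "b \<oplus> f = a \<otimes> e" "d \<oplus> f = c \<otimes> e" "b \<oplus> h = a \<otimes> g" "d \<oplus> h = c \<otimes> g"
      "a \<noteq> c" "(e, f) \<noteq> (g, h)"
    for a b c d e f g h
  proof -
    have "(a \<ominus> c) \<otimes> (e \<ominus> g) = (a \<otimes> e \<ominus> c \<otimes> e) \<ominus> (a \<otimes> g \<ominus> c \<otimes> g)"
      using that(1-8) by algebra
    also have "\<dots> = ((b \<oplus> f) \<ominus> (d \<oplus> f)) \<ominus> ((b \<oplus> h) \<ominus> (d \<oplus> h))"
      using that by simp
    also have "\<dots> = \<zero>"
      using that(1-8) by algebra
    finally have "a \<ominus> c = \<zero> \<or> e \<ominus> g = \<zero>"
      using that(1-8) integral_iff[of "a \<ominus> c" "e \<ominus> g"] by simp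
    then have "e = g"
      using that by (auto simp: r_right_minus_eq)
    with that show False
      by (metis add.l_cancel)
  qed
  \<comment> \<open>In all other cases one explicit point \<open>t\<close> is the only candidate for
    a common polar point.\<close>
  have fixes_w: "w = w'" if "\<And>v. v \<in> points \<Longrightarrow> polar x v \<Longrightarrow> polar y v \<Longrightarrow> v = t" for t
    using 1 that by metis
  have affine_slope: "v = Inl (c, a \<otimes> c \<ominus> b)"
    if "a \<in> carrier R" "b \<in> carrier R" "c \<in> carrier R"
      and "v \<in> points" "polar (Inl (a, b)) v" "polar (Inr (Some c)) v" for a b c v
    using \<open>v \<in> points\<close>
  proof (cases rule: points_cases)
    case (aff e f)
    then have "b \<oplus> f = a \<otimes> c" "e = c" using that by auto
    moreover have "f = (b \<oplus> f) \<ominus> b"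
      using that aff by algebra
    ultimately show ?thesis using aff by simp
  qed (use that in auto)
  from 1 have "x \<in> points" "y \<in> points" by auto
  then show "w = w'"
  proof (cases rule: points_cases[case_product points_cases])
    case (aff_aff a b c d)
    show ?thesis
    proof (cases "a = c")
      case True
      show ?thesis
      proof (rule fixes_w)
        fix v assume v: "v \<in> points" "polar x v" "polar y v"
        from v(1) show "v = Inr (Some a)"
        proof (cases rule: points_cases)
          case (aff e f)
          then have "b \<oplus> f = d \<oplus> f" using v aff_aff True by simp
          then have "b = d" using aff aff_aff by simp
          then show ?thesis using aff_aff True \<open>x \<noteq> y\<close> by simp
        qed (use v aff_aff in auto)
      qed
    next
      case False
      have "\<exists>e f. v = Inl (e, f) \<and> e \<in> carrier R \<and> f \<in> carrier R
          \<and> b \<oplus> f = a \<otimes> e \<and> d \<oplus> f = c \<otimes> e"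
        if v: "v \<in> points" "polar x v" "polar y v" for v
        using v(1) by (cases rule: points_cases) (use v aff_aff False in auto)
      from this[of w] this[of w'] show ?thesis
        using key[of a b c d] 1 aff_aff False by (elim exE conjE) blast
    qed
  next
    case (aff_slope a b c)
    show ?thesis
      by (rule fixes_w) (use aff_slope in \<open>auto intro: affine_slope\<close>)
  next
    case (slope_aff c a b)
    show ?thesis
      by (rule fixes_w) (use slope_aff in \<open>auto intro: affine_slope\<close>)
  next
    case (aff_inf a b)
    show ?thesis
      by (rule fixes_w[of "Inr (Some a)"]) (use aff_inf in \<open>auto elim: points_cases\<close>)
  next
    case (inf_aff a b)
    show ?thesis
      by (rule fixes_w[of "Inr (Some a)"]) (use inf_aff in \<open>auto elim: points_cases\<close>)
  next
    case (slope_slope a b)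
    then show ?thesis
      using \<open>x \<noteq> y\<close> by (intro fixes_w[of "Inr None"]) (auto elim: points_cases)
  next
    case (slope_inf a)
    show ?thesis
      by (rule fixes_w[of "Inr None"]) (use slope_inf in \<open>auto elim: points_cases\<close>)
  next
    case (inf_slope a)
    show ?thesis
      by (rule fixes_w[of "Inr None"]) (use inf_slope in \<open>auto elim: points_cases\<close>)
  next
    case inf_inf
    then show ?thesis using \<open>x \<noteq> y\<close> by simp
  qed
qed (auto intro: polar_sym)

end

lemma polarity_exists:
  assumes "prime_power q"
  obtains P :: "(((int list \<times> nat) multiset \<Rightarrow> int) \<times> ((int list \<times> nat) multiset \<Rightarrow> int)
      + ((int list \<times> nat) multiset \<Rightarrow> int) option) set" and inc z
    where "polarity P inc q" "z \<in> P" "\<not> inc z z"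
proof -
  obtain R :: "((int list \<times> nat) multiset \<Rightarrow> int) ring"
    where R: "domain R" "finite (carrier R)" "card (carrier R) = q"
    using finite_domain_exists[OF assms] .
  interpret R: domain R by fact
  \<comment> \<open>The point is \<open>(0, 1, 0)\<close>, where the quadratic form takes the value
    -1, so it is not absolute.\<close>
  show ?thesis
    using that[OF R.polarity_points[OF R(2,3)], of "Inr (Some \<zero>\<^bsub>R\<^esub>)"] by simp
qed

section \<open>Blocks\<close>

lemma ex_walk_len_if_rtranclp:
  assumes "E\<^sup>*\<^sup>* x y"
  shows "\<exists>k. walk_len E k x y"
  using assms
proof (induction rule: converse_rtranclp_induct)
  case base
  show ?case by (intro exI[of _ 0]) simp
next
  case (step x w)
  then obtain k where "walk_len E k w y" by blast
  with step show ?case by (intro exI[of _ "Suc k"]) auto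
qed

text \<open>Lower bounds on distances are obtained from potentials that rise by at most 1 along an
  edge. The existence of a walk ensures that the minimum defining \<open>gdist\<close> is
  attained.\<close>

lemma potential_le_gdist:
  fixes f :: "'a \<Rightarrow> int"
  assumes lip: "\<And>x y. E x y \<Longrightarrow> f y \<le> f x + 1" and walk: "\<exists>k. walk_len E k x y"
  shows "f y \<le> f x + int (gdist E x y)"
proof -
  have "f y \<le> f x + int k" if "walk_len E k x y" for k x
    using that
  proof (induction k arbitrary: x)
    case (Suc k)
    then obtain w where "E x w" "walk_len E k w y" by auto
    then show ?case using lip[of x w] Suc.IH[of w] by simp
  qed simp
  moreover have "walk_len E (gdist E x y) x y"
    unfolding gdist_def using walk by (rule LeastI_ex)
  ultimately show ?thesis by blast
qed

lemma card_Diff_two: "finite A \<Longrightarrow> card A - 2 \<le> card (A - {x} - {y})"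
  by (auto simp add: card_Diff_singleton_if)

locale block = polarity +
  fixes z u v
  assumes non_absolute: "\<not> inc z z" and inc_u: "inc z u" and inc_v: "inc z v"
    and u_neq_v: "u \<noteq> v" and not_inc_u_v: "\<not> inc u v" and q_ge: "q \<ge> 2"
begin

text \<open>The condition \<open>p \<noteq> r\<close> removes the loops at absolute points. The last
  two conjuncts cut the edges between the neighbourhoods of \<open>u\<close> and
  \<open>v\<close>.\<close>

definition H where
  "H p r \<longleftrightarrow> inc p r \<and> p \<noteq> r \<and> p \<noteq> z \<and> r \<noteq> z
     \<and> \<not> (inc u p \<and> inc v r) \<and> \<not> (inc v p \<and> inc u r)"

text \<open>A potential that is 1-Lipschitz on the block and separates \<open>u\<close> from \<open>v\<close> by 4.\<close>

definition level :: "'a \<Rightarrow> int" where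
  "level p = (if p = u then 0 else if inc u p then 1 else if p = v then 4
     else if inc v p then 3 else 2)"

lemma inc_z_u_v [simp]: "inc z u" "inc z v" "inc u z" "inc v z" "\<not> inc z z"
    "\<not> inc u v" "\<not> inc v u" "u \<noteq> v" "v \<noteq> u" "u \<noteq> z" "v \<noteq> z" "z \<noteq> u" "z \<noteq> v"
  using non_absolute inc_u inc_v u_neq_v not_inc_u_v inc_sym by blast+

lemma inc_u_inc_v: "inc u p \<Longrightarrow> inc v p \<Longrightarrow> p = z"
  using meet_unique[of u v p z] by simp

lemma inc_commute: "inc x y \<longleftrightarrow> inc y x"
  using inc_sym by blast

lemma H_sym: "H p r \<Longrightarrow> H r p"
  unfolding H_def using inc_sym by blast

lemma H_inc: "H p r \<Longrightarrow> inc p r \<and> p \<noteq> r \<and> p \<noteq> z \<and> r \<noteq> z"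
  by (simp add: H_def)

lemma finite_polar [simp]: "finite {r. inc p r}"
  by (rule finite_subset[OF _ finite_points]) (use inc_point inc_sym in blast)

lemma level_bounds: "0 \<le> level p" "level p \<le> 4"
  by (auto simp: level_def)

lemma level_u [simp]: "level u = 0" and level_v [simp]: "level v = 4"
  by (auto simp: level_def)

text \<open>Edges between levels 1 and 3 are exactly the ones that \<open>H\<close> cuts. A
  neighbour of \<open>v\<close> has level 3, because a point polar to both \<open>u\<close> and
  \<open>v\<close> is the deleted \<open>z\<close>.\<close>

lemma H_level: "H p r \<Longrightarrow> level r \<le> level p + 1"
  using inc_u_inc_v[of p] inc_u_inc_v[of r] inc_commute[of u p] inc_commute[of v p]
  unfolding H_def level_def by (auto split: if_splits)

text \<open>Apart from a possible loop, \<open>p\<close> loses at most one neighbour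
  \<open>c\<close>. If \<open>p\<close> is polar to \<open>u\<close>, every lost neighbour,
  \<open>z\<close> included, is a common polar point of \<open>p\<close> and \<open>v\<close>, and
  there is only one such point. The case of \<open>v\<close> is symmetric, and elsewhere only
  \<open>z\<close> can be lost.\<close>

lemma card_H:
  assumes p: "p \<in> P" "p \<noteq> z"
  shows "q - 1 \<le> card {r. H p r}"
proof -
  have "\<exists>c. {r. inc p r} - {p} - {c} \<subseteq> {r. H p r}"
  proof -
    consider "inc u p" | "inc v p" | "\<not> inc u p" "\<not> inc v p" by blast
    then show ?thesis
    proof cases
      case 1
      then have np: "\<not> inc v p" "p \<noteq> v"
        using p inc_u_inc_v inc_z_u_v(6) by blast+
      obtain c where c: "inc p c" "inc v c"
        using meet[of p v] np p inc_point[OF inc_z_u_v(4)] by blast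
      have "r = c" if "inc p r" "r = z \<or> inc v r" for r
        using that meet_unique[of p v r c] c np inc_z_u_v(4) by blast
      then show ?thesis
        using 1 p np unfolding H_def by blast
    next
      case 2
      then have np: "\<not> inc u p" "p \<noteq> u"
        using p inc_u_inc_v inc_z_u_v(7) by blast+
      obtain c where c: "inc p c" "inc u c"
        using meet[of p u] np p inc_point[OF inc_z_u_v(3)] by blast
      have "r = c" if "inc p r" "r = z \<or> inc u r" for r
        using that meet_unique[of p u r c] c np inc_z_u_v(3) by blast
      then show ?thesis
        using 2 p np unfolding H_def by blast
    next
      case 3
      then show ?thesis
        using p unfolding H_def by blast
    qed
  qed
  then obtain c where c: "{r. inc p r} - {p} - {c} \<subseteq> {r. H p r}" by blast
  have "finite {r. H p r}"
    by (rule finite_subset[of _ "{r. inc p r}"]) (auto simp: H_def)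
  then have "card ({r. inc p r} - {p} - {c}) \<le> card {r. H p r}"
    using c by (rule card_mono)
  moreover have "card {r. inc p r} - 2 \<le> card ({r. inc p r} - {p} - {c})"
    by (intro card_Diff_two) simp
  ultimately show ?thesis
    using card_polar[OF p(1)] by simp
qed

text \<open>The common polar point \<open>b\<close> of \<open>s\<close> and \<open>a\<close> is
  used. The edge from \<open>b\<close> to \<open>a\<close> is not cut, since \<open>a\<close> lies
  in neither neighbourhood.\<close>

lemma H_path_to_middle:
  assumes s: "s = u \<or> s = v"
    and a: "a \<in> P" "\<not> inc z a" "a \<noteq> u" "a \<noteq> v" "\<not> inc u a" "\<not> inc v a"
  obtains b where "H s b" "H b a"
proof -
  have "s \<in> P"
    using s inc_point[of u z] inc_point[of v z] by auto
  then obtain b where b: "inc s b" "inc a b"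
    using meet[of s a] a s by blast
  have "b \<noteq> z" using b a inc_sym by blast
  moreover have "b \<noteq> s" using b s a inc_sym by blast
  moreover have "b \<noteq> a" using b s a by blast
  ultimately have "H s b" "H b a"
    using s b a inc_u_inc_v[of b] inc_commute[of a b] unfolding H_def by auto
  then show ?thesis using that by blast
qed

text \<open>Of the \<open>q + 1\<close> points polar to \<open>a\<close>, only \<open>z\<close> and
  the common polar point of \<open>a\<close> and \<open>z\<close> are avoided, so
  \<open>q \<ge> 2\<close> leaves one. Were it polar to \<open>u\<close>, then \<open>a\<close> and
  \<open>u\<close> would share it as well as \<open>z\<close>; likewise for
  \<open>v\<close>.\<close>

lemma middle_exists:
  assumes a: "inc z a" "a \<noteq> u" "a \<noteq> v"
  obtains b where "inc a b" "b \<in> P" "\<not> inc z b" "b \<noteq> z" "b \<noteq> u" "b \<noteq> v" "\<not> inc u b" "\<not> inc v b"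
proof -
  have aP: "a \<in> P" "inc a z" and "a \<noteq> z"
    using a inc_commute[of a z] inc_point[of a z] by auto
  obtain c where c: "inc a c" "inc z c"
    using meet[of a z] aP \<open>a \<noteq> z\<close> inc_point[of z u] by auto
  have "card ({b. inc a b} - {z} - {c}) \<ge> q + 1 - 2"
    using card_polar[OF aP(1)] card_Diff_two[OF finite_polar, of a z c] by simp
  then have "{b. inc a b} - {z} - {c} \<noteq> {}"
    using q_ge by (intro notI) simp
  then obtain b where b: "inc a b" "b \<noteq> z" "b \<noteq> c" by blast
  have "\<not> inc z b"
    using b c meet_unique[of a z b c] \<open>a \<noteq> z\<close> by blast
  moreover have "\<not> inc u b" "\<not> inc v b"
    using b a aP meet_unique[of a u b z] meet_unique[of a v b z] by auto
  moreover have "b \<in> P" using b inc_sym inc_point by blast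
  ultimately show ?thesis
    using that[of b] b inc_z_u_v(1,2) by metis
qed

text \<open>Points polar to none of \<open>z\<close>, \<open>u\<close>, \<open>v\<close> are two
  steps from both \<open>u\<close> and \<open>v\<close>; every remaining point is \<open>u\<close>
  or \<open>v\<close> or adjacent to \<open>u\<close>, to \<open>v\<close> or to such a middle
  point.\<close>

lemma H_connected:
  assumes p: "p \<in> P" "p \<noteq> z"
  shows "H\<^sup>*\<^sup>* u p"
proof -
  have uv: "H\<^sup>*\<^sup>* u v"
  proof -
    \<comment> \<open>As \<open>q + 1 \<ge> 3\<close>, a third point \<open>a\<close> is polar to
      \<open>z\<close>. Its middle neighbour \<open>b\<close> links \<open>u\<close> with
      \<open>v\<close>.\<close>
    have "card ({a. inc z a} - {u} - {v}) \<ge> q + 1 - 2"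
      using card_polar[of z] inc_point[of z u] card_Diff_two[OF finite_polar, of z u v] by simp
    then have "{a. inc z a} - {u} - {v} \<noteq> {}"
      using q_ge by (intro notI) simp
    then obtain a where a: "inc z a" "a \<noteq> u" "a \<noteq> v" by blast
    obtain b where b: "b \<in> P" "\<not> inc z b" "b \<noteq> u" "b \<noteq> v" "\<not> inc u b" "\<not> inc v b"
      using middle_exists[OF a] by blast
    obtain c where "H u c" "H c b"
      using H_path_to_middle[OF disjI1[OF refl] b] .
    then have "H\<^sup>*\<^sup>* u b"
      by (blast intro: rtranclp.rtrancl_into_rtrancl)
    moreover obtain d where "H v d" "H d b"
      using H_path_to_middle[OF disjI2[OF refl] b] .
    then have "H b d" "H d v"
      by (blast intro: H_sym)+
    ultimately show ?thesis
      by (blast intro: rtranclp.rtrancl_into_rtrancl)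
  qed
  have middle: "H\<^sup>*\<^sup>* u b" 
    if b: "b \<in> P" "\<not> inc z b" "b \<noteq> u" "b \<noteq> v" "\<not> inc u b" "\<not> inc v b" for b
  proof -
    obtain c where "H u c" "H c b"
      using H_path_to_middle[OF disjI1[OF refl] b] .
    then show ?thesis
      by (blast intro: rtranclp.rtrancl_into_rtrancl)
  qed
  consider "p = u" | "p = v" | "inc u p" "p \<noteq> u" | "inc v p" "p \<noteq> v"
    | "\<not> inc u p" "\<not> inc v p" "p \<noteq> u" "p \<noteq> v" "\<not> inc z p"
    | "\<not> inc u p" "\<not> inc v p" "p \<noteq> u" "p \<noteq> v" "inc z p" by blast
  then show ?thesis
  proof cases
    case 3
    then have "H u p" using p inc_u_inc_v[of p] by (auto simp: H_def)
    then show ?thesis by simp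
  next
    case 4
    then have "H v p" using p inc_u_inc_v[of p] by (auto simp: H_def)
    then show ?thesis using uv by (rule rtranclp.rtrancl_into_rtrancl[rotated])
  next
    case 5
    then show ?thesis using middle p by blast
  next
    case 6
    obtain b where b: "inc p b" "b \<in> P" "\<not> inc z b" "b \<noteq> z" "b \<noteq> u" "b \<noteq> v"
        "\<not> inc u b" "\<not> inc v b"
      using middle_exists[OF 6(5,3,4)] by blast
    then have "H b p"
      using 6 p inc_commute[of b p] by (auto simp: H_def)
    then show ?thesis
      by (rule rtranclp.rtrancl_into_rtrancl[OF middle[OF b(2,3,5-)]])
  qed (use uv in simp_all)
qed

end

section \<open>The glued graph\<close>

locale chain = block +
  fixes k m :: nat
  assumes k_pos: "k \<ge> 1" and m_pos: "m \<ge> 1"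
begin

text \<open>
  The copy of the point \<open>p\<close> in the \<open>i\<close>-th copy of the plane is \<open>(i, p)\<close>. The copies \<open>1, \<dots>, k\<close> are the
  blocks of the path, the copies \<open>k + 1, \<dots>, k + m\<close> are glued together at the point \<open>z\<close>, which is
  represented once, as \<open>(0, z)\<close>.
\<close>

definition W where
  "W = insert (0, z) ({1..k + m} \<times> (P - {z}))"

text \<open>Copy 0 holds only the hub, which acts as the point \<open>z\<close> of every petal; this
  is the one case of differing first components. Petals keep the full polarity graph, and only path
  blocks are thinned to \<open>H\<close>.\<close>

definition local_edge where
  "local_edge x y \<longleftrightarrow> inc (snd x) (snd y) \<and> snd x \<noteq> snd y \<and>
     (if fst x = fst y then fst x \<le> k \<longrightarrow> H (snd x) (snd y)
      else fst x = 0 \<and> fst y > k \<or> fst y = 0 \<and> fst x > k)"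

text \<open>Bridges are oriented away from the hub, so that \<open>ind\<close> and
  \<open>pot\<close> both grow by 1 along them.\<close>

definition bridge where
  "bridge x y \<longleftrightarrow> (\<exists>i<k. x = (i, if i = 0 then z else v) \<and> y = (Suc i, u))"

definition adj where
  "adj x y \<longleftrightarrow> x \<in> W \<and> y \<in> W \<and> (local_edge x y \<or> bridge x y \<or> bridge y x)"

definition ind :: "nat \<times> 'a \<Rightarrow> nat" where
  "ind x = (if fst x \<le> k then fst x else 0)"

text \<open>One period of 5 consists of 4 levels across a block and 1 along a bridge. Hub and petals
  get the constant 4, as if the hub were the exit \<open>v\<close> of a block at position 0.\<close>

definition pot :: "nat \<times> 'a \<Rightarrow> int" where
  "pot x = (if 1 \<le> fst x \<and> fst x \<le> k then 5 * int (fst x) + level (snd x) else 4)"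

lemma W_cases:
  assumes "x \<in> W"
  obtains (hub) "x = (0, z)"
  | (path) i p where "x = (i, p)" "1 \<le> i" "i \<le> k" "p \<in> P" "p \<noteq> z"
  | (petal) i p where "x = (i, p)" "k < i" "i \<le> k + m" "p \<in> P" "p \<noteq> z"
proof -
  obtain i p where x: "x = (i, p)" by fastforce
  have "x = (0, z) \<or> (1 \<le> i \<and> i \<le> k + m \<and> p \<in> P \<and> p \<noteq> z)"
    using assms by (auto simp: W_def x)
  then show ?thesis
    using hub path[OF x] petal[OF x] by (metis not_le)
qed

lemma finite_W [simp]: "finite W"
  using finite_points by (simp add: W_def)

lemma hub_in_W [simp]: "(0, z) \<in> W"
  by (simp add: W_def)

lemma Pair_in_W: "1 \<le> i \<Longrightarrow> (i, p) \<in> W \<longleftrightarrow> i \<le> k + m \<and> p \<in> P \<and> p \<noteq> z"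
  by (auto simp: W_def)

lemma z_u_v_points [simp]: "z \<in> P" "u \<in> P" "v \<in> P"
  using inc_z_u_v inc_point by blast+

lemma local_edge_sym: "local_edge x y \<Longrightarrow> local_edge y x"
  using inc_sym H_sym by (auto simp: local_edge_def split: if_splits)

lemma adj_sym: "adj x y \<Longrightarrow> adj y x"
  using local_edge_sym[of x y] by (auto simp: adj_def)

lemma adj_irrefl: "\<not> adj x x"
  by (auto simp: adj_def local_edge_def bridge_def)

lemma sgraph_adj: "sgraph W adj"
  using adj_sym adj_irrefl by (auto simp: sgraph_def adj_def)

lemma bridge_ind: "bridge x y \<Longrightarrow> ind y = Suc (ind x)"
  by (auto simp: bridge_def ind_def)

lemma bridge_pot: "bridge x y \<Longrightarrow> pot y = pot x + 1"
  by (auto simp: bridge_def pot_def)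

lemma bridge_unique: "bridge x y \<Longrightarrow> bridge x' y' \<Longrightarrow> ind x = ind x' \<Longrightarrow> x = x' \<and> y = y'"
  by (auto simp: bridge_def ind_def)

lemma local_edge_ind: "local_edge x y \<Longrightarrow> ind x = ind y"
  by (auto simp: local_edge_def ind_def split: if_splits)

lemma local_edge_pot: "local_edge x y \<Longrightarrow> pot y \<le> pot x + 1"
  using H_level[of "snd x" "snd y"] by (auto simp: local_edge_def pot_def split: if_splits)

lemma adj_pot: "adj x y \<Longrightarrow> pot y \<le> pot x + 1"
  using local_edge_pot[of x y] bridge_pot[of x y] bridge_pot[of y x] by (auto simp: adj_def)

lemma pot_bounds: "5 * int (ind x) \<le> pot x" "pot x \<le> 5 * int (ind x) + 4"
  using level_bounds[of "snd x"] by (auto simp: pot_def ind_def)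

section \<open>Absence of four-cycles in the glued graph\<close>

text \<open>A bridge is the only edge between the vertices with \<open>ind\<close> at most
  \<open>ind a\<close> and those beyond, whereas a cycle crosses a cut at least twice.\<close>

lemma no_bridge_on_C4:
  assumes "adj a b" "adj b c" "adj c d" "adj d a" "distinct [a, b, c, d]"
  shows "\<not> bridge a b"
proof
  assume br: "bridge a b"
  have cross: "x = a \<and> y = b" if "adj x y" "ind x \<le> ind a" "ind a < ind y" for x y
  proof -
    have "bridge x y"
      using that local_edge_ind[of x y] bridge_ind[of y x] by (auto simp: adj_def)
    then show ?thesis
      using that bridge_ind[of x y] bridge_unique[OF _ br] by simp
  qed
  have b: "ind a < ind b" using bridge_ind[OF br] by simp
  have c: "ind a < ind c"
    using cross[of c b] adj_sym[OF assms(2)] b assms(5) by fastforce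
  have d: "ind a < ind d"
    using cross[of d c] adj_sym[OF assms(3)] c assms(5) by fastforce
  show False
    using cross[of a d] adj_sym[OF assms(4)] d assms(5) by simp
qed

lemma local_edge_on_C4:
  assumes "adj a b" "adj b c" "adj c d" "adj d a" "distinct [a, b, c, d]"
  shows "local_edge a b"
proof -
  have "\<not> bridge a b"
    using no_bridge_on_C4 assms by blast
  moreover have "\<not> bridge b a"
    using no_bridge_on_C4[of b a d c] assms adj_sym by (auto simp: eq_commute)
  ultimately show ?thesis
    using assms(1) by (simp add: adj_def)
qed

text \<open>Copies of one point in different blocks or petals can have only the hub as a common
  neighbour, so two distinct common neighbours are impossible.\<close>

lemma snd_neq_if_common_neighbours:
  assumes "x \<in> W" "y \<in> W" "w \<in> W" "w' \<in> W" "x \<noteq> y" "w \<noteq> w'"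
    and "local_edge x w" "local_edge y w" "local_edge x w'" "local_edge y w'"
  shows "snd x \<noteq> snd y"
proof
  assume eq: "snd x = snd y"
  have hub: "t = (0, z)" if "t \<in> W" "fst t = 0 \<or> snd t = z" for t
    using that by (auto simp: W_def)
  have "fst x \<noteq> fst y"
    using eq assms(5) by (simp add: prod_eq_iff)
  moreover have "fst x \<noteq> 0" "fst y \<noteq> 0"
    using eq assms(5) hub[OF assms(1)] hub[OF assms(2)] by (metis snd_conv)+
  ultimately have "fst w = 0" "fst w' = 0"
    using assms(7-10) by (auto simp: local_edge_def split: if_splits)
  then show False
    using hub assms(3,4,6) by metis
qed

text \<open>A four-cycle would project to two distinct points of the plane with two distinct common
  polar points.\<close>

lemma no_C4: "\<not> has_C4 W adj"
proof
  assume "has_C4 W adj"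
  then obtain a b c d where W: "a \<in> W" "b \<in> W" "c \<in> W" "d \<in> W"
    and dist: "distinct [a, b, c, d]" and adj: "adj a b" "adj b c" "adj c d" "adj d a"
    unfolding has_C4_def by blast
  have l: "local_edge a b" "local_edge b c" "local_edge c d" "local_edge d a"
    using local_edge_on_C4[of a b c d] local_edge_on_C4[of b c d a]
      local_edge_on_C4[of c d a b] local_edge_on_C4[of d a b c] adj dist by auto
  note l' = l[THEN local_edge_sym]
  have "snd a \<noteq> snd c"
    using snd_neq_if_common_neighbours[of a c b d] W dist l l' by auto
  moreover have "snd b \<noteq> snd d"
    using snd_neq_if_common_neighbours[of b d a c] W dist l l' by auto
  moreover have "inc (snd a) (snd b)" "inc (snd c) (snd b)" "inc (snd a) (snd d)" "inc (snd c) (snd d)"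
    using l l' by (auto simp: local_edge_def)
  ultimately show False
    using meet_unique by blast
qed

section \<open>Vertex degrees\<close>

text \<open>Since \<open>u \<noteq> v\<close>, a vertex other than the hub ends at most one bridge.
  The inserted vertex is its only possible other end, and for \<open>p\<close> outside
  \<open>{u, v}\<close> it is mere slack.\<close>

lemma neighbours_subset:
  assumes x: "(i, p) \<in> W" "i \<ge> 1"
  shows "{y \<in> W. adj (i, p) y} \<subseteq>
    insert (if p = u then (i - 1, if i = 1 then z else v) else (Suc i, u))
      ((\<lambda>r. if r = z then (0, z) else (i, r)) ` {r. inc p r})"
proof
  fix y assume "y \<in> {y \<in> W. adj (i, p) y}"
  then have y: "y \<in> W" "adj (i, p) y" by auto
  obtain j r where jr: "y = (j, r)" by fastforce
  consider "local_edge (i, p) y" | "bridge (i, p) y" | "bridge y (i, p)"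
    using y by (auto simp: adj_def)
  then show "y \<in> insert (if p = u then (i - 1, if i = 1 then z else v) else (Suc i, u))
      ((\<lambda>r. if r = z then (0, z) else (i, r)) ` {r. inc p r})"
  proof cases
    case 1
    then have "inc p r" "j = i \<or> j = 0"
      using x jr by (auto simp: local_edge_def split: if_splits)
    moreover have "y = (if r = z then (0, z) else (i, r))"
      using y jr x \<open>j = i \<or> j = 0\<close> by (auto simp: W_def)
    ultimately show ?thesis by blast
  next
    case 2
    then show ?thesis using x by (auto simp: bridge_def)
  next
    case 3
    then show ?thesis using x by (auto simp: bridge_def)
  qed
qed

lemma degree_le:
  assumes x: "(i, p) \<in> W" "i \<ge> 1"
  shows "Defs.degree W adj (i, p) \<le> q + 2"
proof -
  have p: "p \<in> P"
    using x by (simp add: Pair_in_W)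
  let ?S = "(\<lambda>r. if r = z then (0, z) else (i, r)) ` {r. inc p r}"
  let ?b = "if p = u then (i - 1, if i = 1 then z else v) else (Suc i, u)"
  have "Defs.degree W adj (i, p) \<le> card (insert ?b ?S)"
    unfolding degree_def using neighbours_subset[OF x] by (intro card_mono) simp_all
  also have "\<dots> \<le> Suc (card ?S)"
    by (rule card_insert_le_m1) simp_all
  also have "card ?S \<le> card {r. inc p r}"
    by (intro card_image_le) simp
  finally show ?thesis
    using card_polar[OF p] by simp
qed

text \<open>Path blocks inherit the bound from \<open>H\<close>; in a petal only the loop of an
  absolute point is lost. Bridges can only raise the degree.\<close>

lemma degree_ge:
  assumes x: "(i, p) \<in> W" "i \<ge> 1"
  shows "q - 1 \<le> Defs.degree W adj (i, p)"
proof (cases "i \<le> k")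
  case True
  have p: "p \<in> P" "p \<noteq> z"
    using x by (auto simp: Pair_in_W)
  have "card (Pair i ` {r. H p r}) \<le> Defs.degree W adj (i, p)"
    unfolding degree_def
  proof (rule card_mono)
    show "Pair i ` {r. H p r} \<subseteq> {y \<in> W. adj (i, p) y}"
    proof
      fix y assume "y \<in> Pair i ` {r. H p r}"
      then obtain r where r: "y = (i, r)" "H p r" by blast
      have "r \<in> P"
        using H_inc[OF r(2)] inc_point inc_sym by blast
      then show "y \<in> {y \<in> W. adj (i, p) y}"
        using x True r H_inc[OF r(2)] by (simp add: adj_def local_edge_def Pair_in_W)
    qed
  qed simp
  moreover have "card (Pair i ` {r. H p r}) = card {r. H p r}"
    by (intro card_image) (simp add: inj_on_def)
  ultimately show ?thesis
    using card_H[OF p] by simp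
next
  case False
  have p: "p \<in> P" "p \<noteq> z"
    using x by (auto simp: Pair_in_W)
  let ?f = "\<lambda>r. if r = z then (0, z) else (i, r)"
  have "card (?f ` ({r. inc p r} - {p})) \<le> Defs.degree W adj (i, p)"
    unfolding degree_def
  proof (rule card_mono)
    show "?f ` ({r. inc p r} - {p}) \<subseteq> {y \<in> W. adj (i, p) y}"
    proof
      fix y assume "y \<in> ?f ` ({r. inc p r} - {p})"
      then obtain r where r: "y = ?f r" "inc p r" "p \<noteq> r" by blast
      have "r \<in> P"
        using r inc_point inc_sym by blast
      then show "y \<in> {y \<in> W. adj (i, p) y}"
        using x False r by (cases "r = z") (simp_all add: adj_def local_edge_def Pair_in_W)
    qed
  qed simp
  moreover have "card (?f ` ({r. inc p r} - {p})) = card ({r. inc p r} - {p})"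
    using x by (intro card_image) (auto simp: inj_on_def)
  moreover have "card {r. inc p r} - 1 \<le> card ({r. inc p r} - {p})"
    by (simp add: card_Diff_singleton_if)
  ultimately show ?thesis
    using card_polar[OF p(1)] by simp
qed

lemma degree_hub: "Defs.degree W adj (0, z) = m * (q + 1) + 1"
proof -
  \<comment> \<open>The hub sees \<open>q + 1\<close> vertices in each of the \<open>m\<close>
    petals, and the bridge into the first block adds the final 1.\<close>
  have "{y \<in> W. adj (0, z) y} = insert (1, u) ({k + 1..k + m} \<times> {r. inc z r})"
  proof (intro equalityI subsetI)
    fix y assume "y \<in> {y \<in> W. adj (0, z) y}"
    then have y: "y \<in> W" "adj (0, z) y" by auto
    then show "y \<in> insert (1, u) ({k + 1..k + m} \<times> {r. inc z r})"
      by (cases rule: W_cases) (auto simp: adj_def local_edge_def bridge_def)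
  next
    fix y assume y: "y \<in> insert (1, u) ({k + 1..k + m} \<times> {r. inc z r})"
    then show "y \<in> {y \<in> W. adj (0, z) y}"
    proof (elim insertE)
      assume "y = (1, u)"
      then show ?thesis
        using k_pos by (auto simp: adj_def bridge_def Pair_in_W)
    next
      assume "y \<in> {k + 1..k + m} \<times> {r. inc z r}"
      then obtain i r where "y = (i, r)" "k < i" "i \<le> k + m" "inc z r" by auto
      moreover have "r \<noteq> z" "r \<in> P"
        using \<open>inc z r\<close> inc_point inc_sym inc_z_u_v(5) by blast+
      ultimately show ?thesis
        by (auto simp: adj_def local_edge_def Pair_in_W)
    qed
  qed
  moreover have "(1, u) \<notin> {k + 1..k + m} \<times> {r. inc z r}"
    using k_pos by simp
  ultimately show ?thesis
    using card_polar[of z] by (simp add: degree_def card_cartesian_product)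
qed

lemma max_degree_adj: "max_degree W adj = m * (q + 1) + 1"
  unfolding max_degree_def
proof (rule Max_eqI)
  show "m * (q + 1) + 1 \<in> Defs.degree W adj ` W"
    using degree_hub hub_in_W by (metis imageI)
next
  fix d assume "d \<in> Defs.degree W adj ` W"
  then obtain x where x: "x \<in> W" "d = Defs.degree W adj x" by blast
  \<comment> \<open>Because \<open>m \<ge> 1\<close>, the hub dominates even a block vertex that
    carries a bridge.\<close>
  have le: "q + 2 \<le> m * (q + 1) + 1"
    using mult_le_mono1[OF m_pos, of "q + 1"] by simp
  from x(1) show "d \<le> m * (q + 1) + 1"
  proof (cases rule: W_cases)
    case hub
    then show ?thesis using x degree_hub by simp
  next
    case (path i p)
    then show ?thesis using x degree_le[of i p] le by simp
  next
    case (petal i p)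
    then show ?thesis using x degree_le[of i p] le by simp
  qed
qed simp

lemma min_degree_adj: "q - 1 \<le> min_degree W adj"
proof -
  have "q - 1 \<le> Defs.degree W adj x" if "x \<in> W" for x
    using that
  proof (cases rule: W_cases)
    case hub
    have "q - 1 \<le> m * (q + 1) + 1"
      using mult_le_mono1[OF m_pos, of "q + 1"] by simp
    then show ?thesis using hub degree_hub by simp
  next
    case (path i p)
    then show ?thesis using that degree_ge[of i p] by simp
  next
    case (petal i p)
    then show ?thesis using that degree_ge[of i p] by simp
  qed
  then show ?thesis
    unfolding min_degree_def using hub_in_W by (subst Min_ge_iff) (auto simp del: hub_in_W)
qed

section \<open>Connectedness of the glued graph\<close>

lemma H_path_adj:
  assumes "H\<^sup>*\<^sup>* p r" "p \<in> P" "p \<noteq> z" "1 \<le> i" "i \<le> k"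
  shows "adj\<^sup>*\<^sup>* (i, p) (i, r)"
  using assms(1)
proof (induction rule: rtranclp_induct)
  case (step r s)
  have "r \<in> P" "s \<in> P" "r \<noteq> z" "s \<noteq> z"
    using H_inc[OF step(2)] inc_point inc_sym by blast+
  then have "adj (i, r) (i, s)"
    using step(2) H_inc[OF step(2)] assms(4,5) by (simp add: adj_def local_edge_def Pair_in_W)
  with step.IH show ?case by (rule rtranclp.rtrancl_into_rtrancl)
qed simp

lemma adj_hub_path:
  assumes "1 \<le> i" "i \<le> k"
  shows "adj\<^sup>*\<^sup>* (0, z) (i, u)"
  using assms
proof (induction i rule: dec_induct)
  case base
  have "bridge (0, z) (1, u)"
    using k_pos by (auto simp: bridge_def)
  then have "adj (0, z) (1, u)"
    using k_pos by (simp add: adj_def Pair_in_W)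
  then show ?case by simp
next
  case (step i)
  have "adj\<^sup>*\<^sup>* (i, u) (i, v)"
    using step H_connected[of v] by (intro H_path_adj) auto
  moreover have "bridge (i, v) (Suc i, u)"
    using step by (auto simp: bridge_def)
  then have "adj (i, v) (Suc i, u)"
    using step by (simp add: adj_def Pair_in_W)
  ultimately show ?case
    using step by (meson rtranclp.rtrancl_into_rtrancl rtranclp_trans Suc_leD)
qed

lemma adj_hub:
  assumes "x \<in> W"
  shows "adj\<^sup>*\<^sup>* (0, z) x"
  using assms
proof (cases rule: W_cases)
  case (path i p)
  have "adj\<^sup>*\<^sup>* (i, u) (i, p)"
    using path H_connected[of p] by (intro H_path_adj) auto
  then show ?thesis
    using adj_hub_path[of i] path by (auto intro: rtranclp_trans)
next
  case (petal i p)
  have edge: "adj (0, z) (i, r)" if "inc z r" for r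
  proof -
    have "r \<noteq> z" "r \<in> P"
      using that inc_point inc_sym inc_z_u_v(5) by blast+
    then show ?thesis
      using petal that by (simp add: adj_def local_edge_def Pair_in_W)
  qed
  show ?thesis
  proof (cases "inc z p")
    case True
    then show ?thesis using edge[of p] petal by auto
  next
    case False
    \<comment> \<open>The common polar point of \<open>z\<close> and \<open>p\<close> gives a path
      of length 2 from the hub.\<close>
    obtain r where r: "inc z r" "inc p r"
      using meet[of z p] petal by auto
    then have "r \<noteq> z" "r \<in> P" "r \<noteq> p"
      using False inc_point inc_sym inc_z_u_v(5) by blast+
    then have "adj (i, r) (i, p)"
      using petal r inc_sym[of p r] by (simp add: adj_def local_edge_def Pair_in_W)
    then show ?thesis
      using edge[OF r(1)] petal by (auto intro: converse_rtranclp_into_rtranclp)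
  qed
qed simp

lemma connected_adj: "connected_graph W adj"
  unfolding connected_graph_def
proof (intro ballI)
  fix x y assume "x \<in> W" "y \<in> W"
  moreover have "symp adj\<^sup>*\<^sup>*"
    using adj_sym by (intro symp_rtranclp sympI)
  ultimately have "adj\<^sup>*\<^sup>* x y"
    using adj_hub by (meson rtranclp_trans sympD)
  then show "\<exists>k. walk_len adj k x y"
    by (rule ex_walk_len_if_rtranclp)
qed

section \<open>Order of the graph and sum of all distances\<close>

lemma card_P_minus_z: "card (P - {z}) = q * (q + 1)"
  using finite_points card_points by simp

lemma card_W: "card W = (k + m) * (q * (q + 1)) + 1"
proof -
  have "card W = Suc (card ({1..k + m} \<times> (P - {z})))"
    unfolding W_def using finite_points by (intro card_insert_disjoint) auto
  then show ?thesis
    by (simp only: card_cartesian_product card_P_minus_z) simp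
qed

text \<open>The weights count vertices by position: the hub and its petals share position 0, and
  each of the \<open>k\<close> blocks contributes \<open>q * (q + 1)\<close>.\<close>

lemma sum_ind:
  fixes g :: "nat \<Rightarrow> real"
  shows "(\<Sum>x\<in>W. g (ind x)) = (m * (q * (q + 1)) + 1) * g 0 + q * (q + 1) * (\<Sum>i=1..k. g i)"
proof -
  have split: "{1..k + m} = {1..k} \<union> {k + 1..k + m}"
    using k_pos by auto
  have "(\<Sum>x\<in>W. g (ind x)) = g 0 + (\<Sum>x\<in>{1..k + m} \<times> (P - {z}). g (ind x))"
    unfolding W_def using finite_points by (subst sum.insert) (auto simp: ind_def)
  also have "(\<Sum>x\<in>{1..k + m} \<times> (P - {z}). g (ind x))
      = (\<Sum>i\<in>{1..k + m}. \<Sum>p\<in>P - {z}. g (if i \<le> k then i else 0))"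
    unfolding sum.cartesian_product by (intro sum.cong) (auto simp: ind_def)
  also have "\<dots> = q * (q + 1) * (\<Sum>i\<in>{1..k + m}. g (if i \<le> k then i else 0))"
    by (simp only: sum_constant card_P_minus_z sum_distrib_left)
  also have "(\<Sum>i\<in>{1..k + m}. g (if i \<le> k then i else 0)) = (\<Sum>i=1..k. g i) + m * g 0"
    unfolding split by (subst sum.union_disjoint) auto
  finally show ?thesis by (simp add: algebra_simps)
qed

text \<open>\<open>pot\<close> stays within 4 above \<open>5 * ind\<close>, and using it with both
  signs yields the absolute value. Sparing the diagonal makes the total loss
  \<open>4 n (n - 1)\<close> rather than \<open>4 n^2\<close>.\<close>

lemma gdist_ge:
  assumes "x \<in> W" "y \<in> W"
  shows "5 * \<bar>real (ind x) - real (ind y)\<bar> - (if x = y then 0 else 4) \<le> gdist adj x y"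
proof -
  have walk: "\<exists>n. walk_len adj n x y" "\<exists>n. walk_len adj n y x"
    using connected_adj assms by (auto simp: connected_graph_def)
  have "pot y \<le> pot x + int (gdist adj x y)"
    using adj_pot walk(1) by (rule potential_le_gdist)
  moreover have "- pot y \<le> - pot x + int (gdist adj x y)"
  proof (rule potential_le_gdist[OF _ walk(1)])
    fix a b assume "adj a b"
    then show "- pot b \<le> - pot a + 1"
      using adj_pot[of b a] adj_sym by simp
  qed
  ultimately have "5 * \<bar>int (ind x) - int (ind y)\<bar> - 4 \<le> int (gdist adj x y)"
    using pot_bounds[of x] pot_bounds[of y] by arith
  then have "real_of_int (5 * \<bar>int (ind x) - int (ind y)\<bar> - 4) \<le> real_of_int (int (gdist adj x y))"
    by (simp only: of_int_le_iff)
  then show ?thesis by auto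
qed

text \<open>Applying \<open>sum_ind\<close> in both variables separates pairs of a hub-side vertex
  and a block vertex, the first summand, from pairs of block vertices, the second. All pairs are
  ordered.\<close>

lemma sum_ind_diff:
  "(\<Sum>x\<in>W. \<Sum>y\<in>W. \<bar>real (ind x) - real (ind y)\<bar>)
    = real (m * (q * (q + 1)) + 1) * real (q * (q + 1)) * (real k * (real k + 1))
      + (real (q * (q + 1)))\<^sup>2 * ((real k ^ 3 - real k) / 3)"
proof -
  let ?t = "real (q * (q + 1))" and ?a = "real (m * (q * (q + 1)) + 1)"
  have nat_sum: "(\<Sum>i=1..k. real i) = real k * (real k + 1) / 2"
    by (induction k) (auto simp: field_simps)
  have diff_sum: "(\<Sum>i=1..k. \<Sum>j=1..k. \<bar>real i - real j\<bar>) = (real k ^ 3 - k) / 3"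
  proof (induction k)
    case (Suc k)
    have row: "(\<Sum>i=1..k. \<bar>real i - real (Suc k)\<bar>) = k * (k + 1) / 2"
    proof -
      have "(\<Sum>i=1..k. \<bar>real i - real (Suc k)\<bar>) = (\<Sum>i=1..k. real (Suc k) - real i)"
        by (intro sum.cong) auto
      also have "\<dots> = k * (k + 1) / 2"
        by (induction k) (auto simp: field_simps sum_subtractf)
      finally show ?thesis .
    qed
    moreover have "(\<Sum>j=1..k. \<bar>real (Suc k) - real j\<bar>) = (\<Sum>i=1..k. \<bar>real i - real (Suc k)\<bar>)"
      by (simp only: abs_minus_commute)
    moreover have "(\<Sum>i=1..Suc k. \<Sum>j=1..Suc k. \<bar>real i - real j\<bar>)
        = (\<Sum>i=1..k. \<Sum>j=1..k. \<bar>real i - real j\<bar>) + (\<Sum>i=1..k. \<bar>real i - real (Suc k)\<bar>)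
          + (\<Sum>j=1..k. \<bar>real (Suc k) - real j\<bar>)"
      by (simp add: sum.distrib)
    ultimately show ?case
      unfolding Suc.IH by (simp add: field_simps power3_eq_cube)
  qed simp
  have regroup: "a * (t * s) + t * (a * s + t * d) = a * t * (2 * s) + t\<^sup>2 * d" for a t s d :: real
    by (simp add: power2_eq_square algebra_simps)
  have lin: "(\<Sum>i=1..k. c * real i + d * g i) = c * (\<Sum>i=1..k. real i) + d * (\<Sum>i=1..k. g i)"
    for c d :: real and g by (simp add: sum.distrib sum_distrib_left)
  have inner: "(\<Sum>y\<in>W. \<bar>real a - real (ind y)\<bar>) = ?a * a + ?t * (\<Sum>j=1..k. \<bar>real a - real j\<bar>)" for a
    by (subst sum_ind) simp
  have "(\<Sum>x\<in>W. \<Sum>y\<in>W. \<bar>real (ind x) - real (ind y)\<bar>)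
      = ?a * (?t * (\<Sum>j=1..k. real j))
        + ?t * (\<Sum>i=1..k. ?a * i + ?t * (\<Sum>j=1..k. \<bar>real i - real j\<bar>))"
    unfolding inner by (subst sum_ind) simp
  also have "\<dots> = ?a * ?t * (2 * (\<Sum>i=1..k. real i))
      + ?t\<^sup>2 * (\<Sum>i=1..k. \<Sum>j=1..k. \<bar>real i - real j\<bar>)"
    unfolding lin by (rule regroup)
  also have "\<dots> = ?a * ?t * (real k * (real k + 1)) + ?t\<^sup>2 * ((real k ^ 3 - real k) / 3)"
    unfolding nat_sum diff_sum by (simp add: add.commute)
  finally show ?thesis .
qed

lemma sum_gdist_ge:
  "5 * (\<Sum>x\<in>W. \<Sum>y\<in>W. \<bar>real (ind x) - real (ind y)\<bar>) - 4 * (real (card W) * (real (card W) - 1))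
    \<le> (\<Sum>x\<in>W. \<Sum>y\<in>W. real (gdist adj x y))"
proof -
  have "(\<Sum>x\<in>W. \<Sum>y\<in>W. 5 * \<bar>real (ind x) - real (ind y)\<bar> - (if x = y then 0 else 4))
      \<le> (\<Sum>x\<in>W. \<Sum>y\<in>W. real (gdist adj x y))"
    by (intro sum_mono gdist_ge)
  moreover have "(\<Sum>y\<in>W. if x = y then 0 else 4) = 4 * (real (card W) - 1)" if "x \<in> W" for x
  proof -
    have "(\<Sum>y\<in>W. if x = y then 0 else 4) = (\<Sum>y\<in>W. 4 - (if x = y then 4 else 0 :: real))"
      by (intro sum.cong) auto
    then show ?thesis using that by (simp add: sum_subtractf)
  qed
  then have "(\<Sum>x\<in>W. \<Sum>y\<in>W. if x = y then 0 else (4 :: real))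
      = 4 * (real (card W) * (real (card W) - 1))"
    by simp
  ultimately show ?thesis
    by (simp add: sum_subtractf sum_distrib_left)
qed

end

section \<open>The numerical estimate\<close>

text \<open>Here \<open>t\<close> and \<open>a\<close> stand for \<open>\<theta>\<delta>\<close> and
  \<open>\<theta>\<Delta>\<close>, and \<open>(k + 1) * t\<close> is \<open>M\<close>. The cubic
  terms cancel; the rest is at most \<open>5 n (n - 1)\<close>, by
  \<open>(k + 1) t \<le> n - 1\<close> and \<open>2 k t + 3 a \<le> 3 n\<close>. The available slack
  is 9 = 13 - 4 times \<open>n (n - 1)\<close>.\<close>

lemma wiener_estimate:
  fixes a k n t :: real
  assumes "t > 0" "k \<ge> 1" "a \<ge> t + 1" and n: "n = k * t + a"
  shows "5 / 3 * (((k + 1) * t) * ((k + 1) * t - 1)) * ((n + 2 * a) / t) - 13 * (n * (n - 1))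
    < 5 * (a * t * (k * (k + 1)) + t\<^sup>2 * ((k ^ 3 - k) / 3)) - 4 * (n * (n - 1))"
proof -
  have kt: "0 < k * t"
    using assms by simp
  have n_ge: "(k + 1) * t \<le> n - 1" "0 < (k + 1) * t"
    using assms by (simp_all add: algebra_simps add_pos_pos)
  have "5 / 3 * (((k + 1) * t) * ((k + 1) * t - 1)) * ((n + 2 * a) / t)
      - 5 * (a * t * (k * (k + 1)) + t\<^sup>2 * ((k ^ 3 - k) / 3))
      = 5 / 3 * ((k + 1) * ((k + 1) * t - 1) * (n + 2 * a)) 
      - 5 * (a * t * (k * (k + 1)) + t\<^sup>2 * ((k ^ 3 - k) / 3))"
    using \<open>t > 0\<close> by simp
  also have "\<dots> = 5 / 3 * (((k + 1) * t) * (2 * (k * t) + 3 * a)) - 5 / 3 * ((k + 1) * (k * t + 3 * a))"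
    unfolding n by (simp add: field_simps power2_eq_square power3_eq_cube)
  also have "\<dots> \<le> 5 / 3 * (((k + 1) * t) * (2 * (k * t) + 3 * a))"
    using assms by simp
  also have "\<dots> \<le> 5 / 3 * ((n - 1) * (3 * n))"
  proof (intro mult_left_mono mult_mono)
    show "2 * (k * t) + 3 * a \<le> 3 * n"
      using kt n by linarith
    show "0 \<le> n - 1"
      using kt assms by linarith
    show "0 \<le> 2 * (k * t) + 3 * a"
      using kt assms by linarith
  qed (use n_ge in simp_all)
  also have "\<dots> < 9 * (n * (n - 1))"
  proof -
    have "0 < n * (n - 1)"
      using n_ge by (intro mult_pos_pos) simp_all
    then show ?thesis by (simp add: algebra_simps)
  qed
  finally show ?thesis by simp
qed

section \<open>Wiener index and relabelling by natural numbers\<close>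

text \<open>The double sum does not refer to the order on the vertices, so it can be carried along a
  bijection.\<close>

lemma wiener_double_sum:
  fixes V :: "'a::linorder set"
  assumes fin: "finite V" and sym: "\<And>u v. u \<in> V \<Longrightarrow> v \<in> V \<Longrightarrow> gdist E u v = gdist E v u"
  shows "2 * wiener V E = (\<Sum>u\<in>V. \<Sum>v\<in>V. real (gdist E u v))"
proof -
  let ?d = "\<lambda>(u, v). real (gdist E u v)"
  let ?L = "{(u, v). u \<in> V \<and> v \<in> V \<and> u < v}" and ?G = "{(u, v). u \<in> V \<and> v \<in> V \<and> v < u}"
  let ?D = "(\<lambda>v. (v, v)) ` V"
  have fins: "finite ?L" "finite ?G" "finite ?D"
    using fin by (auto intro: finite_subset[of _ "V \<times> V"])
  have "(\<Sum>u\<in>V. \<Sum>v\<in>V. real (gdist E u v)) = sum ?d (V \<times> V)"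
    by (rule sum.cartesian_product)
  also have "V \<times> V = ?D \<union> (?L \<union> ?G)"
    by auto
  also have "sum ?d \<dots> = sum ?d ?D + sum ?d (?L \<union> ?G)"
    using fins by (intro sum.union_disjoint) auto
  also have "sum ?d (?L \<union> ?G) = sum ?d ?L + sum ?d ?G"
    using fins by (intro sum.union_disjoint) auto
  also have "sum ?d ?D = 0"
  proof (rule sum.neutral, rule ballI)
    fix x assume "x \<in> ?D"
    then obtain v where "x = (v, v)" by blast
    then show "?d x = 0" by (simp add: gdist_def Least_eq_0)
  qed
  also have "sum ?d ?G = sum ?d ?L"
    by (rule sum.reindex_bij_witness[of _ prod.swap prod.swap]) (auto intro: sym)
  finally show ?thesis by (simp add: wiener_def)
qed

lemma walk_len_sym:
  assumes "\<And>x y. E x y \<Longrightarrow> E y x" "walk_len E k x y"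
  shows "walk_len E k y x"
proof -
  \<comment> \<open>Walks unfold at their first edge, so reversal needs extension at the far
    end.\<close>
  have append: "walk_len E (Suc k) x z" if "walk_len E k x y" "E y z" for k x y z
    using that by (induction k arbitrary: x) auto
  from assms(2) show ?thesis
    by (induction k arbitrary: x) (auto intro: append assms(1) simp del: walk_len.simps(2) dest!: iffD1[OF walk_len.simps(2)])
qed

lemma gdist_sym:
  assumes "\<And>x y. E x y \<Longrightarrow> E y x"
  shows "gdist E x y = gdist E y x"
proof -
  have "walk_len E k x y = walk_len E k y x" for k
    using walk_len_sym[of E] assms by blast
  then show ?thesis by (simp add: gdist_def)
qed

text \<open>The graph is transported along a bijection from \<open>{0..<card W}\<close>. Its Wiener
  index is given as a double sum, which makes sense on \<open>W\<close> without a linear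
  order.\<close>

lemma nat_graph_exists:
  assumes graph: "sgraph W E"
  obtains V :: "nat set" and E'
  where "sgraph V E'" "card V = card W" "connected_graph V E' = connected_graph W E"
    "max_degree V E' = max_degree W E" "min_degree V E' = min_degree W E"
    "has_C4 V E' \<longleftrightarrow> has_C4 W E"
    "2 * wiener V E' = (\<Sum>x\<in>W. \<Sum>y\<in>W. real (gdist E x y))"
proof -
  have fin: "finite W" and E_in: "\<And>x y. E x y \<Longrightarrow> x \<in> W \<and> y \<in> W"
    using graph by (auto simp: sgraph_def)
  obtain g where g: "bij_betw g {0..<card W} W"
    using ex_bij_betw_nat_finite[OF fin] by blast
  define V where "V = {0..<card W}"
  define E' where "E' a b \<longleftrightarrow> a \<in> V \<and> b \<in> V \<and> E (g a) (g b)" for a b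
  have gV: "bij_betw g V W"
    using g by (simp add: V_def)
  then have img: "W = g ` V" and inj: "inj_on g V"
    by (auto simp: bij_betw_def)
  have eq: "g a = g b \<longleftrightarrow> a = b" if "a \<in> V" "b \<in> V" for a b
    using inj that by (auto dest: inj_onD)
  have graph': "sgraph V E'"
    using graph by (auto simp: sgraph_def E'_def V_def)
  have walk: "walk_len E' k a b = walk_len E k (g a) (g b)" if "a \<in> V" "b \<in> V" for k a b
    using that(1)
  proof (induction k arbitrary: a)
    case 0
    then show ?case using eq that(2) by simp
  next
    case (Suc k)
    have "(\<exists>w. E' a w \<and> walk_len E' k w b) = (\<exists>w\<in>V. E (g a) (g w) \<and> walk_len E k (g w) (g b))"
      using Suc.IH Suc.prems E'_def by blast
    also have "\<dots> = (\<exists>x\<in>W. E (g a) x \<and> walk_len E k x (g b))"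
      unfolding img by blast
    also have "\<dots> = (\<exists>x. E (g a) x \<and> walk_len E k x (g b))"
      using E_in by blast
    finally show ?case by simp
  qed
  then have dist: "gdist E' a b = gdist E (g a) (g b)" if "a \<in> V" "b \<in> V" for a b
    using that by (simp add: gdist_def)
  have degree: "Defs.degree V E' a = Defs.degree W E (g a)" if a: "a \<in> V" for a
  proof -
    have "{x \<in> W. E (g a) x} = g ` {b \<in> V. E' a b}"
      using a by (auto simp: img E'_def)
    then show ?thesis
      unfolding degree_def using inj by (simp add: card_image inj_on_subset)
  qed
  have degrees: "Defs.degree V E' ` V = Defs.degree W E ` W"
    using degree by (auto simp: img image_image)
  have "2 * wiener V E' = (\<Sum>a\<in>V. \<Sum>b\<in>V. real (gdist E' a b))"
    using graph' by (intro wiener_double_sum gdist_sym) (auto simp: sgraph_def)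
  also have "\<dots> = (\<Sum>a\<in>V. \<Sum>b\<in>V. real (gdist E (g a) (g b)))"
    using dist by simp
  also have "\<dots> = (\<Sum>x\<in>W. \<Sum>y\<in>W. real (gdist E x y))"
    unfolding img using inj by (simp add: sum.reindex)
  finally have wiener: "2 * wiener V E' = \<dots>" .
  have "has_C4 V E' \<longleftrightarrow> has_C4 W E"
    unfolding has_C4_def img by (auto simp: E'_def eq)
  then show ?thesis
    using that[OF graph' _ _ _ _ _ wiener] walk degrees inj
    by (simp add: connected_graph_def max_degree_def min_degree_def img card_image)
qed

section \<open>Choice of the block ends and passage to the average distance\<close>

lemma (in polarity) C4_free_graph_exists:
  assumes z: "z \<in> P" "\<not> inc z z" and q: "q \<ge> 2" and k: "k \<ge> 1" and m: "m \<ge> 1"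
  defines "t \<equiv> real (q * (q + 1))"
  defines "a \<equiv> real m * t + 1"
  defines "n \<equiv> real k * t + a"
  obtains V :: "nat set" and E where "sgraph V E" "card V = (k + m) * (q * (q + 1)) + 1" "connected_graph V E"
    "max_degree V E = m * (q + 1) + 1" "q - 1 \<le> min_degree V E" "\<not> has_C4 V E"
    "avg_dist V E > 5 / 3 * (((real k + 1) * t) * ((real k + 1) * t - 1) / (n * (n - 1))) * ((n + 2 * a) / t) - 13"
proof -
  have fin: "finite {r. inc z r}"
    by (rule finite_subset[OF _ finite_points]) (use inc_point inc_sym in blast)
  have "{r. inc z r} \<noteq> {}"
    using card_polar[OF z(1)] by (intro notI) simp
  then obtain u where u: "inc z u" by blast
  then have uP: "u \<in> P" "u \<noteq> z"
    using inc_sym inc_point z by blast+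
  then obtain c where c: "inc u c" "inc z c"
    using meet[OF uP(1) z(1)] by blast
  \<comment> \<open>Avoiding \<open>c\<close> keeps \<open>v\<close> non-adjacent to
    \<open>u\<close>: otherwise \<open>c\<close> and \<open>v\<close> would be two common polar
    points of \<open>u\<close> and \<open>z\<close>. Of the \<open>q + 1 \<ge> 3\<close> candidates
    one remains.\<close>
  have "card {r. inc z r} - 2 \<le> card ({r. inc z r} - {u} - {c})"
    using fin by (rule card_Diff_two)
  then have "{r. inc z r} - {u} - {c} \<noteq> {}"
    using card_polar[OF z(1)] q by (intro notI) simp
  then obtain v where v: "inc z v" "v \<noteq> u" "v \<noteq> c" by blast
  have "\<not> inc u v"
    using meet_unique[OF uP(2), of c v] c v by blast
  then interpret chain P inc q z u v k m
    using z u v q k m by unfold_locales auto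
  obtain V :: "nat set" and E where VE: "sgraph V E" "card V = card W" "connected_graph V E = connected_graph W adj"
    "max_degree V E = max_degree W adj" "min_degree V E = min_degree W adj"
    "has_C4 V E \<longleftrightarrow> has_C4 W adj"
    "2 * wiener V E = (\<Sum>x\<in>W. \<Sum>y\<in>W. real (gdist adj x y))"
    using nat_graph_exists[OF sgraph_adj] .
  have n: "real (card V) = n"
    unfolding VE(2) card_W n_def a_def t_def by (simp add: algebra_simps)
  have a: "real (m * (q * (q + 1)) + 1) = a"
    by (simp add: a_def t_def)
  have t: "t > 0"
    using q unfolding t_def by (simp only: of_nat_0_less_iff) simp
  have at: "a \<ge> t + 1"
    using m t by (simp add: a_def)
  have "5 / 3 * (((real k + 1) * t) * ((real k + 1) * t - 1)) * ((n + 2 * a) / t) - 13 * (n * (n - 1))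
      < 5 * (a * t * (k * (real k + 1)) + t\<^sup>2 * ((real k ^ 3 - k) / 3)) - 4 * (n * (n - 1))"
    using wiener_estimate[of t "real k" a n] t at k by (simp add: n_def add.commute)
  also have "\<dots> \<le> 2 * wiener V E"
    using sum_gdist_ge unfolding VE(7) sum_ind_diff VE(2)[symmetric] n a t_def[symmetric] .
  finally have W: "5 / 3 * (((real k + 1) * t) * ((real k + 1) * t - 1)) * ((n + 2 * a) / t) - 13 * (n * (n - 1))
      < 2 * wiener V E" .
  have pos: "n * (n - 1) > 0"
  proof (intro mult_pos_pos)
    have "0 \<le> real k * t" using t by simp
    then have "1 < n" using t at unfolding n_def by linarith
    then show "0 < n" "0 < n - 1" by simp_all
  qed
  \<comment> \<open>The factor 1/2 matches the double counting in
    \<open>2 * wiener V E\<close>.\<close>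
  have choose: "real (card V choose 2) = n * (n - 1) / 2"
    unfolding n[symmetric] by (cases "card V") (auto simp: choose_two real_of_nat_div algebra_simps)
  have avg: "avg_dist V E = 2 * wiener V E / (n * (n - 1))"
    unfolding avg_dist_def choose by simp
  have normalise: "5 / 3 * (A / D) * B - 13 = (5 / 3 * A * B - 13 * D) / D" if "D \<noteq> 0" for A B D :: real
    using that by (simp add: field_simps)
  have "5 / 3 * (((real k + 1) * t) * ((real k + 1) * t - 1) / (n * (n - 1))) * ((n + 2 * a) / t) - 13
      = (5 / 3 * (((real k + 1) * t) * ((real k + 1) * t - 1)) * ((n + 2 * a) / t) - 13 * (n * (n - 1))) / (n * (n - 1))"
    by (rule normalise) (use pos in linarith)
  also have "\<dots> < avg_dist V E"
    unfolding avg using W pos by (rule divide_strict_right_mono)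
  finally have "avg_dist V E > 5 / 3 * (((real k + 1) * t) * ((real k + 1) * t - 1) / (n * (n - 1))) * ((n + 2 * a) / t) - 13" .
  then show ?thesis
    using that[OF VE(1)] connected_adj max_degree_adj min_degree_adj no_C4 card_W unfolding VE(2-6) by blast
qed

theorem theorem6p3:
  fixes \<delta> \<Delta> n :: nat
  assumes "\<delta> \<ge> 3"
    and "prime_power (\<delta> + 1)"
    and "\<exists>m::int. m > 0 \<and> int \<Delta> - 1 = m * (int \<delta> + 2)"
    and "\<exists>k::int. k > 0 \<and> int n - (int \<Delta> - 1) * (int \<delta> + 1) - 1 = k * ((int \<delta> + 1) * (int \<delta> + 2))"
  shows "\<exists>(V :: nat set) E. sgraph V E \<and> card V = n \<and> connected_graph V E
     \<and> max_degree V E = \<Delta> \<and> min_degree V E \<ge> \<delta> \<and> \<not> has_C4 V E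
     \<and> (let \<theta>\<Delta> = (real \<Delta> - 1) * (real \<delta> + 1) + 1;
            \<theta>\<delta> = (real \<delta> + 2) * (real \<delta> + 1);
            M = real n - \<theta>\<Delta> + \<theta>\<delta>
        in avg_dist V E > 5 / 3 * (M * (M - 1) / (real n * (real n - 1)))
                            * ((real n + 2 * \<theta>\<Delta>) / \<theta>\<delta>) - 13)"
proof -
  \<comment> \<open>The plane has order \<open>\<delta> + 1\<close>, so the degree bound
    \<open>q - 1\<close> becomes \<open>\<delta>\<close>. The two multipliers in the hypotheses
    become the number \<open>m\<close> of petals and the number \<open>k\<close> of path
    blocks.\<close>
  define q where "q = \<delta> + 1"
  obtain m' k' :: int where mk': "m' > 0" "int \<Delta> - 1 = m' * (int \<delta> + 2)"
    "k' > 0" "int n - (int \<Delta> - 1) * (int \<delta> + 1) - 1 = k' * ((int \<delta> + 1) * (int \<delta> + 2))"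
    using assms(3,4) by blast
  obtain m k :: nat where m: "m \<ge> 1" "m' = int m" and k: "k \<ge> 1" "k' = int k"
    using that[of "nat m'" "nat k'"] mk'(1,3) by simp
  have "int \<Delta> = int (m * (q + 1) + 1)"
    using mk'(2) m by (simp add: q_def algebra_simps)
  then have \<Delta>: "\<Delta> = m * (q + 1) + 1"
    by (simp only: of_nat_eq_iff)
  have "int n = int ((k + m) * (q * (q + 1)) + 1)"
    using mk'(4) k unfolding mk'(2) m by (simp add: q_def algebra_simps)
  then have n: "n = (k + m) * (q * (q + 1)) + 1"
    by (simp only: of_nat_eq_iff)
  obtain P :: "(((int list \<times> nat) multiset \<Rightarrow> int) \<times> ((int list \<times> nat) multiset \<Rightarrow> int)
      + ((int list \<times> nat) multiset \<Rightarrow> int) option) set" and inc z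
    where pol: "polarity P inc q" and z: "z \<in> P" "\<not> inc z z"
    using polarity_exists[of q] assms(2) unfolding q_def by blast
  have q: "q \<ge> 2"
    using assms(1) by (simp add: q_def)
  define t where "t = real (q * (q + 1))"
  obtain V :: "nat set" and E where VE: "sgraph V E" "card V = (k + m) * (q * (q + 1)) + 1" "connected_graph V E"
    "max_degree V E = m * (q + 1) + 1" "q - 1 \<le> min_degree V E" "\<not> has_C4 V E"
    "avg_dist V E > 5 / 3 * (((real k + 1) * t) * ((real k + 1) * t - 1)
        / ((real k * t + (real m * t + 1)) * ((real k * t + (real m * t + 1)) - 1)))
      * (((real k * t + (real m * t + 1)) + 2 * (real m * t + 1)) / t) - 13"
    using polarity.C4_free_graph_exists[OF pol z q k(1) m(1)] unfolding t_def by blast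
  have \<theta>\<Delta>: "(real \<Delta> - 1) * (real \<delta> + 1) + 1 = real m * t + 1"
    by (simp add: \<Delta> t_def q_def algebra_simps)
  have \<theta>\<delta>: "(real \<delta> + 2) * (real \<delta> + 1) = t"
    by (simp add: t_def q_def algebra_simps)
  have rn: "real n = real k * t + (real m * t + 1)"
    by (simp add: n t_def algebra_simps)
  \<comment> \<open>\<open>M\<close> counts the vertices of \<open>k + 1\<close> blocks: the part of
    size \<open>\<theta>\<Delta>\<close> at the hub is replaced by one more block.\<close>
  have M: "real n - (real m * t + 1) + t = (real k + 1) * t"
    unfolding rn by (simp add: algebra_simps)
  have "let \<theta>\<Delta> = (real \<Delta> - 1) * (real \<delta> + 1) + 1;
            \<theta>\<delta> = (real \<delta> + 2) * (real \<delta> + 1);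
            M = real n - \<theta>\<Delta> + \<theta>\<delta>
        in avg_dist V E > 5 / 3 * (M * (M - 1) / (real n * (real n - 1)))
                            * ((real n + 2 * \<theta>\<Delta>) / \<theta>\<delta>) - 13"
    unfolding Let_def \<theta>\<Delta> \<theta>\<delta> M using VE(7) unfolding rn .
  moreover have "card V = n" "max_degree V E = \<Delta>" "\<delta> \<le> min_degree V E"
    using VE(2,4,5) n \<Delta> by (simp_all add: q_def)
  ultimately show ?thesis
    using VE(1,3,6) by blast
qed

end
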